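(* Let $k$ be an algebraically closed field of characteristic $p>0$, let $G$ be a finite group, let $P$ be a $p$-subgroup of $G$, and let $M:=\mathrm{Sc}(G,P)$ be the Scott $kG$-module with vertex $P$. Then the following are equivalent: (1) $M$ is Brauer indecomposable. (2) There exists a normal subgroup $R\unlhd G$ with $R\leq P\cap\ker(M)$ such that for every subgroup $Q$ with $R\leq Q\leq P$, the module $\mathrm{Res}^{N_G(Q)}_{C_G(Q)}\,M(Q)$ is indecomposable.
   Context: All modules are finitely generated left modules; indecomposable modules are nonzero by convention. $k_G$ denotes the trivial $kG$-module, and $\mathrm{Res}^A_B$, $\mathrm{Ind}_B^A$ denote restriction and induction. Scott module: for a $p$-subgroup $P\leq G$, $\mathrm{Sc}(G,P)$ is the unique (up to isomorphism) indecomposable direct summand of $\mathrm{Ind}_P^G\,k_P$ which contains $k_G$ in its top (i.e. has $k_G$ as a quotient). It is a $p$-permutation module with vertex $P$. Kernel: $\ker(M):=\{g\in G \mid gm=m \text{ for all } m\in M\}$. Relative trace and Brauer construction: for $K\leq H\leq G$, $M^K:=\{m\in M\mid \kappa m=m\ \forall \kappa\in K\}$ and $\mathrm{tr}_K^H:M^K\to M^H$, $\mathrm{tr}_K^H(m)=\sum_{h\in[H/K]}hm$, the sum being over representatives of the left cosets of $K$ in $H$. For a $p$-subgroup $Q\leq G$, $M(Q):=M^Q/\sum_{K<Q}\mathrm{tr}_K^Q(M^K)$ (sum over proper subgroups $K$ of $Q$), which is a $kN_G(Q)$-module. Brauer indecomposability: $M=\mathrm{Sc}(G,P)$ is called Brauer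 indecomposable if for every subgroup $Q\leq P$ the module $\mathrm{Res}^{N_G(Q)}_{Q\,C_G(Q)}\,M(Q)$ is indecomposable or zero as a $k(Q\,C_G(Q))$-module. *)

theory Defs
  imports "HOL-Algebra.Algebraic_Closure" "HOL-Algebra.Left_Coset"
begin

definition ring_char :: "('k, 'r) ring_scheme \<Rightarrow> nat" where
  "ring_char k =
     (if \<exists>n>0. add_pow k (n::nat) \<one>\<^bsub>k\<^esub> = \<zero>\<^bsub>k\<^esub>
      then LEAST n. n > 0 \<and> add_pow k (n::nat) \<one>\<^bsub>k\<^esub> = \<zero>\<^bsub>k\<^esub> else 0)"

definition p_subgroup :: "nat \<Rightarrow> 'g set \<Rightarrow> ('g, 'h) monoid_scheme \<Rightarrow> bool" where
  "p_subgroup p P G \<longleftrightarrow> subgroup P G \<and> (\<exists>n. card P = p ^ n)"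

definition centralizer :: "('g, 'h) monoid_scheme \<Rightarrow> 'g set \<Rightarrow> 'g set" where
  "centralizer G Q = {g \<in> carrier G. \<forall>q\<in>Q. g \<otimes>\<^bsub>G\<^esub> q = q \<otimes>\<^bsub>G\<^esub> g}"


section \<open>Modules over a group algebra\<close>

text \<open>
  A left \<open>kG\<close>-module is a \<open>k\<close>-module with a \<open>k\<close>-linear action of \<open>G\<close>. The fields
  \<open>mult\<close> and \<open>one\<close> inherited from the ring record carry no meaning.

  The group is always passed separately from the module. Restriction to a subgroup \<open>H\<close>
  therefore leaves the module record unchanged and replaces the group \<open>G\<close> by
  \<open>G\<lparr>carrier := H\<rparr>\<close>. Likewise a submodule \<open>U\<close> of \<open>M\<close>, seen as a module, is
  \<open>M\<lparr>carrier := U\<rparr>\<close>.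
\<close>

record ('k, 'm, 'g) gmodule = "('k, 'm) module" +
  act :: "'g \<Rightarrow> 'm \<Rightarrow> 'm"

locale kG_module = module k M + G?: group G
  for k :: "('k, 'r) ring_scheme" (structure)
    and G :: "('g, 'h) monoid_scheme" (structure)
    and M :: "('k, 'm, 'g) gmodule" (structure) +
  assumes act_closed:
      "\<lbrakk>g \<in> carrier G; x \<in> carrier M\<rbrakk> \<Longrightarrow> act M g x \<in> carrier M"
    and act_add:
      "\<lbrakk>g \<in> carrier G; x \<in> carrier M; y \<in> carrier M\<rbrakk> \<Longrightarrow>
        act M g (x \<oplus>\<^bsub>M\<^esub> y) = act M g x \<oplus>\<^bsub>M\<^esub> act M g y"
    and act_smult:
      "\<lbrakk>g \<in> carrier G; c \<in> carrier k; x \<in> carrier M\<rbrakk> \<Longrightarrow>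
        act M g (c \<odot>\<^bsub>M\<^esub> x) = c \<odot>\<^bsub>M\<^esub> act M g x"
    and act_one: "x \<in> carrier M \<Longrightarrow> act M \<one>\<^bsub>G\<^esub> x = x"
    and act_mult:
      "\<lbrakk>g \<in> carrier G; h \<in> carrier G; x \<in> carrier M\<rbrakk> \<Longrightarrow>
        act M (g \<otimes>\<^bsub>G\<^esub> h) x = act M g (act M h x)"

definition trivial_module :: "('k, 'r) ring_scheme \<Rightarrow> ('k, 'k, 'g) gmodule" where
  "trivial_module k =
     \<lparr>carrier = carrier k, monoid.mult = undefined, one = undefined,
      zero = \<zero>\<^bsub>k\<^esub>, add = add k, smult = monoid.mult k, act = (\<lambda>g x. x)\<rparr>"

definition gsubmodule ::
  "('k, 'r) ring_scheme \<Rightarrow> ('g, 'h) monoid_scheme \<Rightarrow> ('k, 'm, 'g) gmodule \<Rightarrow> 'm set \<Rightarrow> bool" where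
  "gsubmodule k G M U \<longleftrightarrow>
     submodule U k M \<and> (\<forall>g\<in>carrier G. \<forall>u\<in>U. act M g u \<in> U)"

definition direct_decomposition ::
  "('k, 'r) ring_scheme \<Rightarrow> ('g, 'h) monoid_scheme \<Rightarrow> ('k, 'm, 'g) gmodule \<Rightarrow>
    'm set \<Rightarrow> 'm set \<Rightarrow> bool" where
  "direct_decomposition k G M U V \<longleftrightarrow>
     gsubmodule k G M U \<and> gsubmodule k G M V \<and>
     U <+>\<^bsub>M\<^esub> V = carrier M \<and> U \<inter> V = {\<zero>\<^bsub>M\<^esub>}"

definition indecomposable ::
  "('k, 'r) ring_scheme \<Rightarrow> ('g, 'h) monoid_scheme \<Rightarrow> ('k, 'm, 'g) gmodule \<Rightarrow> bool" where
  "indecomposable k G M \<longleftrightarrow>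
     carrier M \<noteq> {\<zero>\<^bsub>M\<^esub>} \<and>
     (\<forall>U V. direct_decomposition k G M U V \<longrightarrow> U = {\<zero>\<^bsub>M\<^esub>} \<or> V = {\<zero>\<^bsub>M\<^esub>})"

definition kG_hom ::
  "('k, 'r) ring_scheme \<Rightarrow> ('g, 'h) monoid_scheme \<Rightarrow>
    ('k, 'm, 'g) gmodule \<Rightarrow> ('k, 'n, 'g) gmodule \<Rightarrow> ('m \<Rightarrow> 'n) set" where
  "kG_hom k G M N =
     {f \<in> carrier M \<rightarrow> carrier N.
        (\<forall>x\<in>carrier M. \<forall>y\<in>carrier M. f (x \<oplus>\<^bsub>M\<^esub> y) = f x \<oplus>\<^bsub>N\<^esub> f y) \<and>
        (\<forall>c\<in>carrier k. \<forall>x\<in>carrier M. f (c \<odot>\<^bsub>M\<^esub> x) = c \<odot>\<^bsub>N\<^esub> f x) \<and>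
        (\<forall>g\<in>carrier G. \<forall>x\<in>carrier M. f (act M g x) = act N g (f x))}"

definition kG_isomorphic ::
  "('k, 'r) ring_scheme \<Rightarrow> ('g, 'h) monoid_scheme \<Rightarrow>
    ('k, 'm, 'g) gmodule \<Rightarrow> ('k, 'n, 'g) gmodule \<Rightarrow> bool" where
  "kG_isomorphic k G M N \<longleftrightarrow> (\<exists>f\<in>kG_hom k G M N. bij_betw f (carrier M) (carrier N))"

definition module_kernel :: "('g, 'h) monoid_scheme \<Rightarrow> ('k, 'm, 'g) gmodule \<Rightarrow> 'g set" where
  "module_kernel G M = {g \<in> carrier G. \<forall>m\<in>carrier M. act M g m = m}"

text \<open>
  The quotient of \<open>M\<close> by \<open>N\<close>. The operations on cosets are written as unions over
  representatives, as in the library's \<open>rcoset_mult\<close>; the union has only one distinct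
  member whenever the operation preserves \<open>N\<close>.
\<close>

definition quotient_module :: "('k, 'm, 'g) gmodule \<Rightarrow> 'm set \<Rightarrow> ('k, 'm set, 'g) gmodule" where
  "quotient_module M N =
     \<lparr>carrier = a_rcosets\<^bsub>M\<^esub> N, monoid.mult = undefined, one = undefined,
      zero = N, add = set_add M,
      smult = (\<lambda>c A. \<Union>x\<in>A. N +>\<^bsub>M\<^esub> (c \<odot>\<^bsub>M\<^esub> x)),
      act = (\<lambda>g A. \<Union>x\<in>A. N +>\<^bsub>M\<^esub> (act M g x))\<rparr>"


section \<open>Induction\<close>

text \<open>
  For a finite group \<open>G\<close> with subgroup \<open>H\<close> and a \<open>kH\<close>-module \<open>N\<close>, the induced module
  \<open>kG \<otimes>\<^bsub>kH\<^esub> N\<close> is the quotient of \<open>kG \<otimes>\<^bsub>k\<^esub> N\<close> by the \<open>k\<close>-span of all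
  \<open>gh \<otimes> n - g \<otimes> hn\<close>. As \<open>kG\<close> is \<open>k\<close>-free on the finite set \<open>G\<close>, the module
  \<open>kG \<otimes>\<^bsub>k\<^esub> N\<close> consists of the functions from \<open>G\<close> to \<open>N\<close>, where \<open>g \<otimes> n\<close> is the function
  with value \<open>n\<close> at \<open>g\<close> and zero elsewhere; \<open>G\<close> acts by left multiplication on \<open>kG\<close>.
\<close>

definition tensor_kG :: "('g, 'h) monoid_scheme \<Rightarrow> ('k, 'n, 'g) gmodule \<Rightarrow>
    ('k, 'g \<Rightarrow> 'n, 'g) gmodule" where
  "tensor_kG G N =
     \<lparr>carrier = carrier G \<rightarrow>\<^sub>E carrier N, monoid.mult = undefined, one = undefined,
      zero = (\<lambda>x\<in>carrier G. \<zero>\<^bsub>N\<^esub>),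
      add = (\<lambda>a b. \<lambda>x\<in>carrier G. a x \<oplus>\<^bsub>N\<^esub> b x),
      smult = (\<lambda>c a. \<lambda>x\<in>carrier G. c \<odot>\<^bsub>N\<^esub> a x),
      act = (\<lambda>g a. \<lambda>x\<in>carrier G. a (inv\<^bsub>G\<^esub> g \<otimes>\<^bsub>G\<^esub> x))\<rparr>"

definition pure_tensor ::
  "('g, 'h) monoid_scheme \<Rightarrow> ('k, 'n, 'g) gmodule \<Rightarrow> 'g \<Rightarrow> 'n \<Rightarrow> ('g \<Rightarrow> 'n)" where
  "pure_tensor G N g n = (\<lambda>x\<in>carrier G. if x = g then n else \<zero>\<^bsub>N\<^esub>)"

definition tensor_relations ::
  "('g, 'h) monoid_scheme \<Rightarrow> 'g set \<Rightarrow> ('k, 'n, 'g) gmodule \<Rightarrow> ('g \<Rightarrow> 'n) set" where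
  "tensor_relations G H N =
     {pure_tensor G N (g \<otimes>\<^bsub>G\<^esub> h) n \<ominus>\<^bsub>tensor_kG G N\<^esub> pure_tensor G N g (act N h n) | g h n.
        g \<in> carrier G \<and> h \<in> H \<and> n \<in> carrier N}"

definition Ind ::
  "('k, 'r) ring_scheme \<Rightarrow> ('g, 'h) monoid_scheme \<Rightarrow> 'g set \<Rightarrow> ('k, 'n, 'g) gmodule \<Rightarrow>
    ('k, ('g \<Rightarrow> 'n) set, 'g) gmodule" where
  "Ind k G H N =
     quotient_module (tensor_kG G N)
       (\<Inter>{S. submodule S k (tensor_kG G N) \<and> tensor_relations G H N \<subseteq> S})"


section \<open>Scott modules\<close>

text \<open>
  \<open>M\<close> is a copy of the Scott module \<open>Sc(G,P)\<close>, which is defined up to isomorphism.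
  Finite generation is implied, as \<open>G\<close> is finite and \<open>M\<close> is a summand of \<open>Ind\<close>.
\<close>

definition Scott_module ::
  "('k, 'r) ring_scheme \<Rightarrow> ('g, 'h) monoid_scheme \<Rightarrow> 'g set \<Rightarrow> ('k, 'm, 'g) gmodule \<Rightarrow> bool" where
  "Scott_module k G P M \<longleftrightarrow>
     kG_module k G M \<and> indecomposable k G M \<and>
     (\<exists>U V. direct_decomposition k G (Ind k G P (trivial_module k)) U V \<and>
        kG_isomorphic k G M ((Ind k G P (trivial_module k))\<lparr>carrier := U\<rparr>)) \<and>
     (\<exists>f\<in>kG_hom k G M (trivial_module k). f ` carrier M = carrier (trivial_module k :: ('k, 'k, 'g) gmodule))"


section \<open>The Brauer construction\<close>

definition fixed_points :: "('k, 'm, 'g) gmodule \<Rightarrow> 'g set \<Rightarrow> 'm set" where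
  "fixed_points M K = {m \<in> carrier M. \<forall>g\<in>K. act M g m = m}"

text \<open>The relative trace sums over one chosen element of each left coset of \<open>K\<close> in \<open>H\<close>.\<close>

definition rel_trace ::
  "('g, 'h) monoid_scheme \<Rightarrow> ('k, 'm, 'g) gmodule \<Rightarrow> 'g set \<Rightarrow> 'g set \<Rightarrow> 'm \<Rightarrow> 'm" where
  "rel_trace G M K H m =
     (\<Oplus>\<^bsub>M\<^esub>C\<in>lcosets\<^bsub>G\<lparr>carrier := H\<rparr>\<^esub> K. act M (SOME h. h \<in> C) m)"

definition proper_subgroups :: "('g, 'h) monoid_scheme \<Rightarrow> 'g set \<Rightarrow> 'g set set" where
  "proper_subgroups G Q = {K. subgroup K G \<and> K \<subset> Q}"

text \<open>The sum of the submodules \<open>tr\<^bsub>K\<^esub>\<^bsup>Q\<^esup>(M\<^bsup>K\<^esup>)\<close> over the proper subgroups \<open>K\<close> of \<open>Q\<close>.\<close>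

definition trace_sum ::
  "('g, 'h) monoid_scheme \<Rightarrow> ('k, 'm, 'g) gmodule \<Rightarrow> 'g set \<Rightarrow> 'm set" where
  "trace_sum G M Q =
     {(\<Oplus>\<^bsub>M\<^esub>K\<in>proper_subgroups G Q. x K) | x.
        \<forall>K\<in>proper_subgroups G Q. x K \<in> rel_trace G M K Q ` fixed_points M K}"

text \<open>
  The Brauer construction \<open>M(Q)\<close>. The action is meaningful for elements of \<open>N\<^bsub>G\<^esub>(Q)\<close>,
  in particular for those of \<open>C\<^bsub>G\<^esub>(Q)\<close> and of \<open>Q C\<^bsub>G\<^esub>(Q)\<close>.
\<close>

definition Brauer ::
  "('g, 'h) monoid_scheme \<Rightarrow> ('k, 'm, 'g) gmodule \<Rightarrow> 'g set \<Rightarrow> ('k, 'm set, 'g) gmodule" where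
  "Brauer G M Q = quotient_module (M\<lparr>carrier := fixed_points M Q\<rparr>) (trace_sum G M Q)"

definition Brauer_indecomposable ::
  "('k, 'r) ring_scheme \<Rightarrow> ('g, 'h) monoid_scheme \<Rightarrow> 'g set \<Rightarrow> ('k, 'm, 'g) gmodule \<Rightarrow> bool" where
  "Brauer_indecomposable k G P M \<longleftrightarrow>
     (\<forall>Q. subgroup Q G \<and> Q \<subseteq> P \<longrightarrow>
        indecomposable k (G\<lparr>carrier := Q <#>\<^bsub>G\<^esub> centralizer G Q\<rparr>) (Brauer G M Q) \<or>
        carrier (Brauer G M Q) = {\<zero>\<^bsub>Brauer G M Q\<^esub>})"

end

theory Submission
  imports Defs "HOL-Algebra.Zassenhaus" "HOL-Computational_Algebra.Primes"
begin

text \<open>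
  Since \<open>Q\<close> acts trivially on \<open>M(Q)\<close>, the \<open>Q C\<^sub>G(Q)\<close>-submodules and the \<open>C\<^sub>G(Q)\<close>-submodules of
  \<open>M(Q)\<close> coincide, so (1) implies (2) with \<open>R = 1\<close> once \<open>M(Q) \<noteq> 0\<close> for \<open>Q \<le> P\<close>. A surjection
  \<open>f : M \<rightarrow> k\<close> vanishes on proper relative traces, because the indices are divisible by \<open>p\<close>,
  but not on the component in \<open>M\<close> of the \<open>P\<close>-fixed generator of \<open>Ind\<^sub>P\<^sup>G k\<close>; hence
  \<open>M(Q) \<noteq> 0\<close>.

  Conversely, if \<open>R\<close> is normal in \<open>G\<close> and acts trivially on \<open>M\<close>, then \<open>M(Q)\<close> and \<open>M(QR)\<close> are
  equal: the fixed points agree, and \<open>tr\<^sub>K\<^sup>Q = n tr\<^sub>L\<^sup>H\<close> on \<open>M\<^sup>L\<close> for \<open>H = QL\<close> and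
  \<open>n = |Q \<inter> L : K|\<close> identifies the sums of proper traces. It remains to use
  \<open>C\<^sub>G(QR) \<le> C\<^sub>G(Q)\<close>.
\<close>

section \<open>Preliminaries on rings, modules and \<open>p\<close>-groups\<close>

text \<open>Minimality of \<open>p\<close> and division with remainder show that the
  \<open>n\<close>-fold sum of \<open>\<one>\<close> vanishes exactly when \<open>p dvd n\<close>.
  This sum is multiplicative in \<open>n\<close>, so the absence of zero divisors gives Euclid's
  property for \<open>p\<close>.\<close>

lemma (in domain) ring_char_is_prime:
  assumes "ring_char R = p" and "p > 0"
  shows "Factorial_Ring.prime p"
proof -
  let ?P = "\<lambda>n::nat. n > 0 \<and> [n] \<cdot> \<one> = \<zero>"
  have ex: "\<exists>n>0. [(n::nat)] \<cdot> \<one> = \<zero>" and p: "p = (LEAST n. ?P n)"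
    using assms unfolding ring_char_def by (auto split: if_splits)
  have Pp: "?P p"
    using ex unfolding p by (auto intro: LeastI2)
  have min: "[n] \<cdot> \<one> \<noteq> \<zero>" if "0 < n" "n < p" for n :: nat
    using that not_less_Least[of n ?P] unfolding p by auto
  have "p \<noteq> 1"
    using Pp by auto
  show ?thesis
  proof (rule prime_natI)
    show "p \<ge> 2" using \<open>p \<noteq> 1\<close> \<open>p > 0\<close> by simp
  next
    fix a b assume "p dvd a * b"
    have mul: "[(a * b)] \<cdot> \<one> = ([a] \<cdot> \<one>) \<otimes> ([b] \<cdot> \<one>)" for a b :: nat
      by (simp add: add_pow_ldistr add.nat_pow_pow mult.commute)
    have red: "[(n mod p)] \<cdot> \<one> = [n] \<cdot> \<one>" for n :: nat
    proof -
      have "[n] \<cdot> \<one> = [((n div p) * p + n mod p)] \<cdot> \<one>" by simp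
      also have "\<dots> = [((n div p) * p)] \<cdot> \<one> \<oplus> [(n mod p)] \<cdot> \<one>"
        by (rule add.nat_pow_mult[symmetric]) simp
      finally show ?thesis using Pp by (simp add: mul)
    qed
    have dvd: "p dvd n \<longleftrightarrow> [n] \<cdot> \<one> = \<zero>" for n :: nat
      using red[of n] min[of "n mod p"] \<open>p > 0\<close> by (cases "n mod p = 0") (auto simp: dvd_eq_mod_eq_0)
    show "p dvd a \<or> p dvd b"
      using \<open>p dvd a * b\<close> integral unfolding dvd mul by simp
  qed
qed

text \<open>Makes coset counts divisible by \<open>p\<close> vanish as coefficients in
  \<open>M\<close>.\<close>

lemma (in cring) ring_char_dvd_imp:
  assumes "ring_char R dvd n" and "ring_char R > 0"
  shows "[(n::nat)] \<cdot> \<one> = \<zero>"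
proof -
  have "[ring_char R] \<cdot> \<one> = \<zero>"
    using assms(2) unfolding ring_char_def by (auto split: if_splits intro: LeastI2)
  then show ?thesis
    using assms(1) by (metis add.nat_pow_one add.nat_pow_pow dvdE one_closed)
qed

text \<open>Closure under negation, a separate premise of \<open>submoduleI\<close>, comes from the
  scalar \<open>\<ominus> \<one>\<close>.\<close>

lemma (in module) submodule_smultI:
  assumes "H \<subseteq> carrier M" "\<zero>\<^bsub>M\<^esub> \<in> H"
    and "\<And>x y. \<lbrakk>x \<in> H; y \<in> H\<rbrakk> \<Longrightarrow> x \<oplus>\<^bsub>M\<^esub> y \<in> H"
    and sm: "\<And>c x. \<lbrakk>c \<in> carrier R; x \<in> H\<rbrakk> \<Longrightarrow> c \<odot>\<^bsub>M\<^esub> x \<in> H"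
  shows "submodule H R M"
proof (rule submoduleI)
  show "\<ominus>\<^bsub>M\<^esub> a \<in> H" if "a \<in> H" for a
    using sm[of "\<ominus> \<one>" a] smult_l_minus[of \<one> a] that assms(1) by auto
qed (use assms in auto)

lemma (in module) submodule_zero_closed:
  assumes "submodule S R M"
  shows "\<zero>\<^bsub>M\<^esub> \<in> S"
  using subgroup.one_closed[OF submodule.axioms(1)[OF assms]] by simp

lemma (in module) submodule_finsum_closed:
  assumes "submodule S R M" "\<And>i. i \<in> A \<Longrightarrow> f i \<in> S"
  shows "(\<Oplus>\<^bsub>M\<^esub>i\<in>A. f i) \<in> S"
  using assms(2)
proof (induct A rule: infinite_finite_induct)
  case (insert x F)
  then show ?case
    using submoduleE(1,5)[OF assms(1)] by (subst M.finsum_insert) auto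
\<comment> \<open>A sum over an infinite index set has the default value zero, which also lies in
  \<open>S\<close>.\<close>
qed (auto simp: submodule_zero_closed[OF assms(1)])

text \<open>Turns multiplicities, which arise as iterated sums in \<open>M\<close>, into scalars of
  \<open>R\<close>, where the characteristic can be used.\<close>

lemma (in module) add_pow_eq_smult:
  assumes "x \<in> carrier M"
  shows "[(n::nat)] \<cdot>\<^bsub>M\<^esub> x = ([n] \<cdot> \<one>) \<odot>\<^bsub>M\<^esub> x"
  by (induct n) (simp_all add: assms smult_l_distr)

text \<open>By Lagrange \<open>card K\<close> divides a power of the prime \<open>p\<close>, hence
  is itself a power of \<open>p\<close>.\<close>

lemma (in group) p_subgroup_subset:
  assumes "p_subgroup p H G" "Factorial_Ring.prime p" "subgroup K G" "K \<subseteq> H"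
  shows "p_subgroup p K G"
proof -
  obtain n where n: "card H = p ^ n" and H: "subgroup H G"
    using assms by (auto simp: p_subgroup_def)
  have "card K dvd order (G\<lparr>carrier := H\<rparr>)"
    using group.lagrange[OF subgroup.subgroup_is_group[OF H group_axioms]]
      subgroup_incl[OF assms(3) H assms(4)] by (metis dvd_triv_right)
  then have "card K dvd p ^ n" using n by (simp add: order_def)
  then show ?thesis
    using assms(2,3) by (auto simp: p_subgroup_def divides_primepow_nat)
qed

text \<open>The index divides \<open>card H\<close>, so it is some \<open>p ^ i\<close>; here
  \<open>i = 0\<close> would force \<open>card K = card H\<close>.\<close>

lemma (in group) p_subgroup_dvd_index:
  assumes "p_subgroup p H G" "finite H" "Factorial_Ring.prime p" "subgroup K G" "K \<subset> H"
  shows "p dvd card ((\<lambda>h. h <#\<^bsub>G\<^esub> K) ` H)"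
proof -
  obtain n where n: "card H = p ^ n" and H: "subgroup H G"
    using assms by (auto simp: p_subgroup_def)
  have eq: "card ((\<lambda>h. h <#\<^bsub>G\<^esub> K) ` H) * card K = card H"
    using group.l_lagrange[OF subgroup.subgroup_is_group[OF H group_axioms]]
      subgroup_incl[OF assms(4) H] assms(2,5)
    by (auto simp: LCOSETS_def order_def UNION_singleton_eq_range)
  have "card K < card H" using assms psubset_card_mono by blast
  then have "card ((\<lambda>h. h <#\<^bsub>G\<^esub> K) ` H) \<noteq> 1" using eq by auto
  moreover obtain i where "card ((\<lambda>h. h <#\<^bsub>G\<^esub> K) ` H) = p ^ i"
    using eq n assms(3) by (metis divides_primepow_nat dvd_triv_left)
  ultimately show ?thesis by (cases i) auto
qed

section \<open>Relative traces and the Brauer construction\<close>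

context kG_module
begin

section \<open>Fixed points and coset representatives\<close>

lemma act_zero: "g \<in> carrier G \<Longrightarrow> act M g \<zero>\<^bsub>M\<^esub> = \<zero>\<^bsub>M\<^esub>"
  using act_smult[of g "\<zero>" "\<zero>\<^bsub>M\<^esub>"] act_closed by simp

lemma fixed_points_submodule:
  assumes "K \<subseteq> carrier G"
  shows "submodule (fixed_points M K) k M"
proof (rule submodule_smultI)
  show "\<zero>\<^bsub>M\<^esub> \<in> fixed_points M K"
    using assms by (auto simp: fixed_points_def act_zero)
qed (use assms in \<open>auto simp: fixed_points_def act_add act_smult\<close>)

lemma fixed_points_carrier: "m \<in> fixed_points M K \<Longrightarrow> m \<in> carrier M"
  by (simp add: fixed_points_def)

text \<open>The chosen representative is \<open>q\<close> times an element of \<open>K\<close>,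
  which fixes \<open>m\<close>. Hence the arbitrary choice in \<open>rel_trace\<close> has no effect
  on \<open>K\<close>-fixed points.\<close>

lemma act_coset_representative:
  assumes "subgroup K G" "q \<in> carrier G" "m \<in> fixed_points M K"
  shows "act M (SOME h. h \<in> q <#\<^bsub>G\<^esub> K) m = act M q m"
proof -
  have "q \<in> q <#\<^bsub>G\<^esub> K" using assms by (simp add: G.lcos_self)
  then have "(SOME h. h \<in> q <#\<^bsub>G\<^esub> K) \<in> q <#\<^bsub>G\<^esub> K" by (rule someI)
  then obtain x where x: "x \<in> K" "(SOME h. h \<in> q <#\<^bsub>G\<^esub> K) = q \<otimes>\<^bsub>G\<^esub> x"
    by (auto simp: l_coset_def)
  then have "x \<in> carrier G" using assms(1) subgroup.subset by blast
  then show ?thesis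
    using x assms by (simp add: act_mult fixed_points_def)
qed

section \<open>Relative traces and their behaviour under change of subgroups\<close>

lemma rel_trace_eq:
  "rel_trace G M K H m =
    (\<Oplus>\<^bsub>M\<^esub>C\<in>(\<lambda>h. h <#\<^bsub>G\<^esub> K) ` H. act M (SOME h. h \<in> C) m)"
  unfolding rel_trace_def LCOSETS_def by (auto intro!: arg_cong[where f = "finsum M _"])

lemma act_representative_closed:
  assumes "subgroup K G" "H \<subseteq> carrier G" "C \<in> (\<lambda>h. h <#\<^bsub>G\<^esub> K) ` H" "m \<in> fixed_points M K"
  shows "act M (SOME h. h \<in> C) m \<in> carrier M"
  using assms by (auto simp: act_coset_representative act_closed fixed_points_carrier)

lemma rel_trace_closed:
  assumes "subgroup K G" "H \<subseteq> carrier G" "m \<in> fixed_points M K"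
  shows "rel_trace G M K H m \<in> carrier M"
  unfolding rel_trace_eq using assms
  by (intro M.finsum_closed) (auto simp: act_representative_closed)

lemma rel_trace_add:
  assumes "subgroup K G" "H \<subseteq> carrier G" "x \<in> fixed_points M K" "y \<in> fixed_points M K"
  shows "rel_trace G M K H (x \<oplus>\<^bsub>M\<^esub> y) = rel_trace G M K H x \<oplus>\<^bsub>M\<^esub> rel_trace G M K H y"
proof -
  have xy: "x \<oplus>\<^bsub>M\<^esub> y \<in> fixed_points M K"
    using assms submoduleE(5)[OF fixed_points_submodule] subgroup.subset by blast
  show ?thesis
    unfolding rel_trace_eq
  proof (subst M.finsum_addf[symmetric], goal_cases)
    case 3
    show ?case
      using assms xy
      by (intro M.finsum_cong')
        (auto simp: act_coset_representative act_add act_closed fixed_points_carrier subset_iff)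
  qed (use assms act_representative_closed in auto)
qed

lemma rel_trace_smult:
  assumes "subgroup K G" "H \<subseteq> carrier G" "finite H" "x \<in> fixed_points M K" "c \<in> carrier k"
  shows "rel_trace G M K H (c \<odot>\<^bsub>M\<^esub> x) = c \<odot>\<^bsub>M\<^esub> rel_trace G M K H x"
proof -
  have cx: "c \<odot>\<^bsub>M\<^esub> x \<in> fixed_points M K"
    using assms submoduleE(4)[OF fixed_points_submodule] subgroup.subset by blast
  show ?thesis
    unfolding rel_trace_eq using assms cx
    by (subst finsum_smult_ldistr)
      (auto simp: act_representative_closed act_coset_representative act_smult act_closed
        fixed_points_carrier subset_iff intro!: M.finsum_cong')
qed

text \<open>The only coset is \<open>Q\<close> itself, and its representative fixes
  \<open>m\<close>.\<close>

lemma rel_trace_self: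
  assumes "subgroup Q G" "m \<in> fixed_points M Q"
  shows "rel_trace G M Q Q m = m"
proof -
  have "(\<lambda>h. h <#\<^bsub>G\<^esub> Q) ` Q = {Q}"
    using assms(1) G.coset_join3 subgroup.one_closed[OF assms(1)] subgroup.subset[OF assms(1)] by blast
  moreover have "act M (SOME h. h \<in> Q) m = m"
    using assms subgroup.one_closed[OF assms(1)] by (metis (mono_tags, lifting) fixed_points_def mem_Collect_eq someI)
  ultimately show ?thesis
    unfolding rel_trace_eq using assms fixed_points_carrier by simp
qed

text \<open>The map \<open>qK \<mapsto> qL\<close> from \<open>Q/K\<close> to \<open>H/L\<close> is onto because \<open>H = QL\<close>, and
  left translation by \<open>q\<close> identifies \<open>(Q \<inter> L)/K\<close> with its fibre over \<open>qL\<close>.\<close>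

lemma rel_trace_compare:
  assumes K: "subgroup K G" and L: "subgroup L G" and Q: "subgroup Q G" and H: "subgroup H G"
    and "K \<subseteq> Q" "K \<subseteq> L" and "finite H" and H_eq: "H = Q <#>\<^bsub>G\<^esub> L"
    and m: "m \<in> fixed_points M L"
  shows "rel_trace G M K Q m =
    ([card ((\<lambda>h. h <#\<^bsub>G\<^esub> K) ` (Q \<inter> L))] \<cdot> \<one>) \<odot>\<^bsub>M\<^esub> rel_trace G M L H m"
proof -
  let ?F = "\<lambda>C. act M (SOME h. h \<in> C) m"
  define A where "A = (\<lambda>q. q <#\<^bsub>G\<^esub> K) ` Q"
  define B where "B = (\<lambda>q. q <#\<^bsub>G\<^esub> L) ` H"
  define Z where "Z = (\<lambda>h. h <#\<^bsub>G\<^esub> K) ` (Q \<inter> L)"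
  \<comment> \<open>Right multiplication by the set \<open>L\<close> realises the map from
    \<open>Q/K\<close> to \<open>H/L\<close> without naming representatives.\<close>
  define fib where "fib C = {D \<in> A. D <#>\<^bsub>G\<^esub> L = C}" for C
  have sub: "K \<subseteq> carrier G" "L \<subseteq> carrier G" "Q \<subseteq> carrier G" "H \<subseteq> carrier G"
    using K L Q H subgroup.subset by blast+
  have QH: "Q \<subseteq> H"
    unfolding H_eq set_mult_def using subgroup.one_closed[OF L] sub by force
  have finQ: "finite Q" using QH \<open>finite H\<close> finite_subset by blast
  have mK: "m \<in> fixed_points M K"
    using m \<open>K \<subseteq> L\<close> by (auto simp: fixed_points_def)
  have KL: "K <#>\<^bsub>G\<^esub> L = L"
  proof
    show "K <#>\<^bsub>G\<^esub> L \<subseteq> L"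
      using \<open>K \<subseteq> L\<close> subgroup.m_closed[OF L] by (auto simp: set_mult_def)
    show "L \<subseteq> K <#>\<^bsub>G\<^esub> L"
      using subgroup.one_closed[OF K] sub by (force simp: set_mult_def)
  qed
  have map: "(q <#\<^bsub>G\<^esub> K) <#>\<^bsub>G\<^esub> L = q <#\<^bsub>G\<^esub> L" if "q \<in> carrier G" for q
    using that sub KL by (simp add: G.setmult_lcos_assoc)
  have absorb: "(q \<otimes>\<^bsub>G\<^esub> l) <#\<^bsub>G\<^esub> L = q <#\<^bsub>G\<^esub> L" if "q \<in> carrier G" "l \<in> L" for q l
    using that sub G.lcos_m_assoc[of L q l] G.coset_join3[OF _ L, of l] by auto
  have B_eq: "B = (\<lambda>q. q <#\<^bsub>G\<^esub> L) ` Q"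
  proof
    show "B \<subseteq> (\<lambda>q. q <#\<^bsub>G\<^esub> L) ` Q"
      unfolding B_def H_eq set_mult_def using absorb sub by auto
  qed (use QH B_def in auto)
  have card_fib: "card (fib C) = card Z" if C: "C \<in> B" for C
  proof -
    obtain q where q: "q \<in> Q" "C = q <#\<^bsub>G\<^esub> L" using C unfolding B_eq by auto
    have qG: "q \<in> carrier G" using q sub by auto
    have ZG: "E \<subseteq> carrier G" if "E \<in> Z" for E
      using that sub G.l_coset_subset_G[of K] unfolding Z_def by blast
    have "inj_on (\<lambda>E. q <#\<^bsub>G\<^esub> E) Z"
    proof (rule inj_on_inverseI)
      show "inv\<^bsub>G\<^esub> q <#\<^bsub>G\<^esub> (q <#\<^bsub>G\<^esub> E) = E" if "E \<in> Z" for E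
        using ZG[OF that] qG by (simp add: G.lcos_m_assoc G.lcos_mult_one)
    qed
    moreover have "(\<lambda>E. q <#\<^bsub>G\<^esub> E) ` Z = fib C"
    proof
      show "(\<lambda>E. q <#\<^bsub>G\<^esub> E) ` Z \<subseteq> fib C"
      proof
        fix D assume "D \<in> (\<lambda>E. q <#\<^bsub>G\<^esub> E) ` Z"
        then obtain h where h: "h \<in> Q" "h \<in> L" "D = q <#\<^bsub>G\<^esub> (h <#\<^bsub>G\<^esub> K)" by (auto simp: Z_def)
        have "D = (q \<otimes>\<^bsub>G\<^esub> h) <#\<^bsub>G\<^esub> K"
          using h qG sub by (auto simp: G.lcos_m_assoc)
        moreover have "q \<otimes>\<^bsub>G\<^esub> h \<in> Q" using subgroup.m_closed[OF Q] q h by blast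
        ultimately show "D \<in> fib C"
          using map absorb[OF qG h(2)] q sub unfolding fib_def A_def by auto
      qed
      show "fib C \<subseteq> (\<lambda>E. q <#\<^bsub>G\<^esub> E) ` Z"
      proof
        fix D assume "D \<in> fib C"
        then obtain r where r: "r \<in> Q" "D = r <#\<^bsub>G\<^esub> K" "r <#\<^bsub>G\<^esub> L = q <#\<^bsub>G\<^esub> L"
          using map sub q unfolding fib_def A_def by auto
        have rG: "r \<in> carrier G" using r sub by auto
        have "r \<in> q <#\<^bsub>G\<^esub> L" using G.lcos_self[OF rG L] r by simp
        then obtain l where l: "l \<in> L" "r = q \<otimes>\<^bsub>G\<^esub> l" by (auto simp: l_coset_def)
        have lG: "l \<in> carrier G" using l sub by auto
        have "l = inv\<^bsub>G\<^esub> q \<otimes>\<^bsub>G\<^esub> r"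
          using l qG lG by (simp add: G.m_assoc[symmetric])
        then have "l \<in> Q"
          using q r subgroup.m_closed[OF Q] subgroup.m_inv_closed[OF Q] by simp
        then have "l <#\<^bsub>G\<^esub> K \<in> Z" using l by (auto simp: Z_def)
        moreover have "D = q <#\<^bsub>G\<^esub> (l <#\<^bsub>G\<^esub> K)"
          using l r qG lG sub by (simp add: G.lcos_m_assoc)
        ultimately show "D \<in> (\<lambda>E. q <#\<^bsub>G\<^esub> E) ` Z" by blast
      qed
    qed
    ultimately show ?thesis using card_image by metis
  qed
  \<comment> \<open>Since \<open>m\<close> is fixed by \<open>K\<close> and by \<open>L\<close>,
    both representatives act on it as the same \<open>q\<close>; the summand is therefore constant
    along each fibre.\<close>
  have F_map: "?F D = ?F (D <#>\<^bsub>G\<^esub> L)" if "D \<in> A" for D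
    using that sub map act_coset_representative[OF K _ mK] act_coset_representative[OF L _ m]
    unfolding A_def by auto
  have FX: "?F D \<in> carrier M" if "D \<in> A" for D
    using act_representative_closed[OF K sub(3) _ mK] that unfolding A_def by blast
  have FY: "?F C \<in> carrier M" if "C \<in> B" for C
    using act_representative_closed[OF L sub(4) _ m] that unfolding B_def by blast
  have finA: "finite A" "finite B" using finQ by (auto simp: A_def B_eq)
  have A_eq: "A = \<Union> (fib ` B)"
    using map sub(3) unfolding fib_def A_def B_eq by (auto simp: subset_iff)
  let ?n = "[card Z] \<cdot> \<one>"
  have "rel_trace G M K Q m = (\<Oplus>\<^bsub>M\<^esub>D\<in>A. ?F D)"
    by (simp add: rel_trace_eq A_def)
  \<comment> \<open>The sum over \<open>Q/K\<close> is grouped by fibres over \<open>H/L\<close>;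
    each fibre then contributes \<open>card Z\<close> equal summands.\<close>
  also have "\<dots> = (\<Oplus>\<^bsub>M\<^esub>C\<in>B. \<Oplus>\<^bsub>M\<^esub>D\<in>fib C. ?F D)"
    unfolding A_eq
    by (rule M.add.finprod_UN_disjoint)
      (use finA FX in \<open>auto simp: fib_def pairwise_def disjnt_def\<close>)
  also have "\<dots> = (\<Oplus>\<^bsub>M\<^esub>C\<in>B. ?n \<odot>\<^bsub>M\<^esub> ?F C)"
  proof (rule M.finsum_cong')
    fix C assume C: "C \<in> B"
    have "(\<Oplus>\<^bsub>M\<^esub>D\<in>fib C. ?F D) = (\<Oplus>\<^bsub>M\<^esub>D\<in>fib C. ?F C)"
      by (rule M.finsum_cong') (use F_map FY[OF C] in \<open>auto simp: fib_def\<close>)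
    also have "\<dots> = [card Z] \<cdot>\<^bsub>M\<^esub> ?F C"
      using M.add.finprod_const[OF FY[OF C], of "fib C"] card_fib[OF C] by simp
    finally show "(\<Oplus>\<^bsub>M\<^esub>D\<in>fib C. ?F D) = ?n \<odot>\<^bsub>M\<^esub> ?F C"
      using FY[OF C] by (simp add: add_pow_eq_smult)
  qed (use FY in auto)
  also have "\<dots> = ?n \<odot>\<^bsub>M\<^esub> (\<Oplus>\<^bsub>M\<^esub>C\<in>B. ?F C)"
    using finA FY by (subst finsum_smult_ldistr) auto
  also have "(\<Oplus>\<^bsub>M\<^esub>C\<in>B. ?F C) = rel_trace G M L H m"
    by (simp add: rel_trace_eq B_def)
  finally show ?thesis unfolding Z_def .
qed

section \<open>The submodule generated by the proper traces\<close>

lemma finite_proper_subgroups: "finite Q \<Longrightarrow> finite (proper_subgroups G Q)"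
  by (rule finite_subset[of _ "Pow Q"]) (auto simp: proper_subgroups_def)

text \<open>Reduces a containment of \<open>trace_sum\<close> in a submodule to single traces;
  together with \<open>trace_sumI\<close> it makes \<open>trace_sum\<close> the submodule generated
  by them.\<close>

lemma trace_sum_least:
  assumes "submodule S k M"
    and "\<And>K m. \<lbrakk>K \<in> proper_subgroups G Q; m \<in> fixed_points M K\<rbrakk> \<Longrightarrow> rel_trace G M K Q m \<in> S"
  shows "trace_sum G M Q \<subseteq> S"
  unfolding trace_sum_def using assms(2)
  by (auto intro!: submodule_finsum_closed[OF assms(1)])

lemma zero_fixed: "K \<subseteq> carrier G \<Longrightarrow> \<zero>\<^bsub>M\<^esub> \<in> fixed_points M K"
  by (rule submodule_zero_closed[OF fixed_points_submodule])

lemma rel_trace_zero: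
  assumes "subgroup K G" "H \<subseteq> carrier G" "finite H"
  shows "rel_trace G M K H \<zero>\<^bsub>M\<^esub> = \<zero>\<^bsub>M\<^esub>"
proof -
  have "\<zero>\<^bsub>M\<^esub> \<in> fixed_points M K"
    by (rule zero_fixed[OF subgroup.subset[OF assms(1)]])
  then show ?thesis
    using rel_trace_smult[OF assms, of "\<zero>\<^bsub>M\<^esub>" \<zero>] rel_trace_closed[OF assms(1,2)] by simp
qed

lemma trace_sumI:
  assumes "finite Q" "Q \<subseteq> carrier G" "K \<in> proper_subgroups G Q" "m \<in> fixed_points M K"
  shows "rel_trace G M K Q m \<in> trace_sum G M Q"
proof -
  \<comment> \<open>The family is the given trace at \<open>K\<close> and zero elsewhere. It is
    admissible because zero is the trace of zero from every proper subgroup.\<close>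
  let ?x = "\<lambda>L. if K = L then rel_trace G M L Q m else \<zero>\<^bsub>M\<^esub>"
  have cl: "rel_trace G M K Q m \<in> carrier M"
    using assms rel_trace_closed by (auto simp: proper_subgroups_def)
  have "(\<Oplus>\<^bsub>M\<^esub>L\<in>proper_subgroups G Q. ?x L) = (\<Oplus>\<^bsub>M\<^esub>L\<in>proper_subgroups G Q. if K = L then rel_trace G M K Q m else \<zero>\<^bsub>M\<^esub>)"
    by (intro arg_cong[where f = "\<lambda>f. finsum M f _"]) auto
  also have "\<dots> = rel_trace G M K Q m"
    using M.finsum_singleton[OF assms(3) finite_proper_subgroups[OF assms(1)], of "\<lambda>_. rel_trace G M K Q m"] cl
    by simp
  finally have eq: "rel_trace G M K Q m = (\<Oplus>\<^bsub>M\<^esub>L\<in>proper_subgroups G Q. ?x L)" by simp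
  have "?x L \<in> rel_trace G M L Q ` fixed_points M L" if "L \<in> proper_subgroups G Q" for L
  proof (cases "K = L")
    case False
    have "L \<subseteq> carrier G" "subgroup L G"
      using that assms(2) by (auto simp: proper_subgroups_def)
    then show ?thesis
      using False rel_trace_zero[OF _ assms(2,1), of L] zero_fixed[of L]
      by (auto simp del: set_eq_subset simp: image_iff intro!: bexI[of _ "\<zero>\<^bsub>M\<^esub>"])
  qed (use assms(4) in auto)
  then show ?thesis
    unfolding trace_sum_def using eq by blast
qed

text \<open>Sums and scalar multiples are formed componentwise in the families indexed by proper
  subgroups; each component stays a trace because the relative trace is linear on fixed
  points.\<close>

lemma trace_sum_submodule:
  assumes "finite Q" "Q \<subseteq> carrier G"
  shows "submodule (trace_sum G M Q) k M"
proof -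
  let ?S = "proper_subgroups G Q"
  have sg: "subgroup K G" "K \<subseteq> carrier G" if "K \<in> ?S" for K
    using that assms(2) by (auto simp: proper_subgroups_def)
  have cl: "x K \<in> carrier M"
    if "\<forall>K\<in>?S. x K \<in> rel_trace G M K Q ` fixed_points M K" "K \<in> ?S" for x K
    using that rel_trace_closed[OF sg(1) assms(2)] by fastforce
  show ?thesis
  proof (rule submodule_smultI)
    show "trace_sum G M Q \<subseteq> carrier M"
      by (rule trace_sum_least[OF carrier_is_submodule]) (use sg assms rel_trace_closed in auto)
    have "\<zero>\<^bsub>M\<^esub> = (\<Oplus>\<^bsub>M\<^esub>K\<in>?S. rel_trace G M K Q \<zero>\<^bsub>M\<^esub>)"
      using sg rel_trace_zero assms by (simp cong: M.finsum_cong)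
    then show "\<zero>\<^bsub>M\<^esub> \<in> trace_sum G M Q"
      unfolding trace_sum_def using zero_fixed sg by blast
  next
    fix a b assume "a \<in> trace_sum G M Q" "b \<in> trace_sum G M Q"
    then obtain x y where
      x: "\<forall>K\<in>?S. x K \<in> rel_trace G M K Q ` fixed_points M K" "a = (\<Oplus>\<^bsub>M\<^esub>K\<in>?S. x K)" and
      y: "\<forall>K\<in>?S. y K \<in> rel_trace G M K Q ` fixed_points M K" "b = (\<Oplus>\<^bsub>M\<^esub>K\<in>?S. y K)"
      unfolding trace_sum_def by blast
    have "a \<oplus>\<^bsub>M\<^esub> b = (\<Oplus>\<^bsub>M\<^esub>K\<in>?S. x K \<oplus>\<^bsub>M\<^esub> y K)"
      using cl[OF x(1)] cl[OF y(1)] x(2) y(2) by (subst M.finsum_addf) auto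
    moreover have "x K \<oplus>\<^bsub>M\<^esub> y K \<in> rel_trace G M K Q ` fixed_points M K" if K: "K \<in> ?S" for K
    proof -
      obtain u v where "u \<in> fixed_points M K" "v \<in> fixed_points M K"
        "x K = rel_trace G M K Q u" "y K = rel_trace G M K Q v"
        using bspec[OF x(1) K] bspec[OF y(1) K] by auto
      then show ?thesis
        using rel_trace_add[OF sg(1)[OF that] assms(2), of u v, symmetric]
          submoduleE(5)[OF fixed_points_submodule[OF sg(2)[OF that]]] by auto
    qed
    ultimately show "a \<oplus>\<^bsub>M\<^esub> b \<in> trace_sum G M Q"
      unfolding trace_sum_def by (auto intro!: exI[of _ "\<lambda>K. x K \<oplus>\<^bsub>M\<^esub> y K"])
  next
    fix c a assume c: "c \<in> carrier k" and "a \<in> trace_sum G M Q"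
    then obtain x where
      x: "\<forall>K\<in>?S. x K \<in> rel_trace G M K Q ` fixed_points M K" "a = (\<Oplus>\<^bsub>M\<^esub>K\<in>?S. x K)"
      unfolding trace_sum_def by blast
    have "c \<odot>\<^bsub>M\<^esub> a = (\<Oplus>\<^bsub>M\<^esub>K\<in>?S. c \<odot>\<^bsub>M\<^esub> x K)"
      using cl[OF x(1)] x(2) c finite_proper_subgroups[OF assms(1)]
      by (subst finsum_smult_ldistr[symmetric]) auto
    moreover have "c \<odot>\<^bsub>M\<^esub> x K \<in> rel_trace G M K Q ` fixed_points M K" if K: "K \<in> ?S" for K
    proof -
      obtain u where "u \<in> fixed_points M K" "x K = rel_trace G M K Q u"
        using bspec[OF x(1) K] by auto
      then show ?thesis
        using rel_trace_smult[OF sg(1)[OF that] assms(2,1), of u c, symmetric] c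
          submoduleE(4)[OF fixed_points_submodule[OF sg(2)[OF that]]] by auto
    qed
    ultimately show "c \<odot>\<^bsub>M\<^esub> a \<in> trace_sum G M Q"
      unfolding trace_sum_def by (auto intro!: exI[of _ "\<lambda>K. c \<odot>\<^bsub>M\<^esub> x K"])
  qed
qed

lemma act_finsum:
  assumes "g \<in> carrier G" "\<And>i. i \<in> A \<Longrightarrow> f i \<in> carrier M" "finite A"
  shows "act M g (\<Oplus>\<^bsub>M\<^esub>i\<in>A. f i) = (\<Oplus>\<^bsub>M\<^esub>i\<in>A. act M g (f i))"
  using assms(3,2)
proof (induct A)
  case empty
  show ?case using assms(1) by (simp add: act_zero)
next
  case (insert i A)
  then show ?case
    using assms(1) by (simp add: act_add act_closed Pi_def)
qed

text \<open>Left multiplication by \<open>q\<close> permutes the cosets of \<open>K\<close> in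
  \<open>Q\<close>, so applying \<open>q\<close> only reorders the summands of the trace.\<close>

lemma rel_trace_fixed:
  assumes K: "subgroup K G" and Q: "subgroup Q G" "finite Q" and m: "m \<in> fixed_points M K"
  shows "rel_trace G M K Q m \<in> fixed_points M Q"
proof -
  have QG: "Q \<subseteq> carrier G" and KG: "K \<subseteq> carrier G" using K Q subgroup.subset by blast+
  let ?A = "(\<lambda>h. h <#\<^bsub>G\<^esub> K) ` Q" and ?F = "\<lambda>C. act M (SOME h. h \<in> C) m"
  note F = act_representative_closed[OF K QG _ m]
  have "act M q (rel_trace G M K Q m) = rel_trace G M K Q m" if q: "q \<in> Q" for q
  proof -
    have qG: "q \<in> carrier G" using q QG by auto
    have sub: "C \<subseteq> carrier G" if "C \<in> ?A" for C
      using that QG KG G.l_coset_subset_G by blast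
    have tr: "q <#\<^bsub>G\<^esub> (h <#\<^bsub>G\<^esub> K) = (q \<otimes>\<^bsub>G\<^esub> h) <#\<^bsub>G\<^esub> K" if "h \<in> Q" for h
      using that qG QG KG by (intro G.lcos_m_assoc) auto
    have inj: "inj_on (\<lambda>C. q <#\<^bsub>G\<^esub> C) ?A"
    proof (rule inj_on_inverseI)
      show "inv\<^bsub>G\<^esub> q <#\<^bsub>G\<^esub> (q <#\<^bsub>G\<^esub> E) = E" if "E \<in> ?A" for E
        using sub[OF that] qG by (simp add: G.lcos_m_assoc G.lcos_mult_one)
    qed
    have "(\<lambda>C. q <#\<^bsub>G\<^esub> C) ` ?A \<subseteq> ?A"
      using tr subgroup.m_closed[OF Q(1) q] by auto
    then have im: "(\<lambda>C. q <#\<^bsub>G\<^esub> C) ` ?A = ?A"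
      by (intro endo_inj_surj inj) (use Q(2) in auto)
    have "act M q (rel_trace G M K Q m) = (\<Oplus>\<^bsub>M\<^esub>C\<in>?A. act M q (?F C))"
      unfolding rel_trace_eq using qG F Q(2) by (intro act_finsum) auto
    also have "\<dots> = (\<Oplus>\<^bsub>M\<^esub>C\<in>?A. ?F (q <#\<^bsub>G\<^esub> C))"
    proof (rule M.finsum_cong')
      fix C assume "C \<in> ?A"
      then obtain h where h: "h \<in> Q" "C = h <#\<^bsub>G\<^esub> K" by auto
      then show "act M q (?F C) = ?F (q <#\<^bsub>G\<^esub> C)"
        using qG QG subgroup.m_closed[OF Q(1) q h(1)] fixed_points_carrier[OF m]
        by (auto simp: tr act_coset_representative[OF K _ m] act_mult subset_iff)
    qed (use F imageI[of _ ?A "\<lambda>C. q <#\<^bsub>G\<^esub> C", unfolded im] in auto)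
    also have "\<dots> = (\<Oplus>\<^bsub>M\<^esub>C\<in>(\<lambda>C. q <#\<^bsub>G\<^esub> C) ` ?A. ?F C)"
      by (rule M.finsum_reindex[symmetric]) (use inj im F in auto)
    also have "\<dots> = rel_trace G M K Q m"
      unfolding im rel_trace_eq ..
    finally show ?thesis .
  qed
  then show ?thesis
    using rel_trace_closed[OF K QG m] by (simp add: fixed_points_def)
qed

text \<open>Ensures that all elements of a coset in \<open>M(Q)\<close>, and not just one
  representative, are fixed by \<open>Q\<close>.\<close>

lemma trace_sum_subset_fixed_points:
  assumes "subgroup Q G" "finite Q"
  shows "trace_sum G M Q \<subseteq> fixed_points M Q"
  by (rule trace_sum_least[OF fixed_points_submodule[OF subgroup.subset[OF assms(1)]]])
    (use assms rel_trace_fixed in \<open>auto simp: proper_subgroups_def\<close>)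

text \<open>On \<open>Q\<close>-fixed points the trace is multiplication by the index of
  \<open>K\<close> in \<open>Q\<close>, which is divisible by \<open>p\<close>. This is
  \<open>rel_trace_compare\<close> with both \<open>L\<close> and \<open>H\<close> equal to
  \<open>Q\<close>.\<close>

lemma rel_trace_of_fixed_eq_zero:
  assumes p: "ring_char k = p" "Factorial_Ring.prime p"
    and Q: "p_subgroup p Q G" "finite Q"
    and K: "subgroup K G" "K \<subset> Q" and m: "m \<in> fixed_points M Q"
  shows "rel_trace G M K Q m = \<zero>\<^bsub>M\<^esub>"
proof -
  have sQ: "subgroup Q G" using Q by (simp add: p_subgroup_def)
  have "rel_trace G M K Q m =
      ([card ((\<lambda>h. h <#\<^bsub>G\<^esub> K) ` (Q \<inter> Q))] \<cdot> \<one>) \<odot>\<^bsub>M\<^esub> rel_trace G M Q Q m"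
    using K sQ Q(2) m G.subgroup_mult_id[OF sQ] by (intro rel_trace_compare) auto
  moreover have "[card ((\<lambda>h. h <#\<^bsub>G\<^esub> K) ` (Q \<inter> Q))] \<cdot> \<one> = \<zero>"
    using G.p_subgroup_dvd_index[OF Q p(2) K] p
    by (intro ring_char_dvd_imp) (auto simp: prime_gt_0_nat)
  ultimately show ?thesis
    using m by (simp add: rel_trace_self[OF sQ] fixed_points_carrier)
qed

section \<open>Normal subgroups acting trivially\<close>

lemma fixed_points_set_mult_kernel:
  assumes "K \<subseteq> carrier G" "R \<subseteq> module_kernel G M" "\<one>\<^bsub>G\<^esub> \<in> R"
  shows "fixed_points M (K <#>\<^bsub>G\<^esub> R) = fixed_points M K"
proof
  show "fixed_points M (K <#>\<^bsub>G\<^esub> R) \<subseteq> fixed_points M K"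
    using assms(1,3) by (force simp: fixed_points_def set_mult_def)
  \<comment> \<open>A product of elements of \<open>K\<close> and \<open>R\<close> acts on
    \<open>M\<close> as its factor from \<open>K\<close>.\<close>
  show "fixed_points M K \<subseteq> fixed_points M (K <#>\<^bsub>G\<^esub> R)"
    using assms by (auto simp: fixed_points_def set_mult_def module_kernel_def act_mult subset_iff)
qed

text \<open>Let \<open>H\<close> be \<open>QR\<close>. A proper subgroup \<open>K\<close> of
  \<open>Q\<close> or of \<open>H\<close> is enlarged to \<open>L = KR\<close>, which has the same
  fixed points. If \<open>L = H\<close>, the trace vanishes because \<open>m\<close> is fixed by the
  whole target. Otherwise traces into \<open>Q\<close> and into \<open>H\<close> are both compared
  with the trace from \<open>L\<close> to \<open>H\<close>.\<close>

lemma trace_sum_set_mult_kernel: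
  assumes p: "ring_char k = p" "Factorial_Ring.prime p"
    and Q: "subgroup Q G" and R: "R \<lhd> G" "R \<subseteq> module_kernel G M"
    and QR: "p_subgroup p (Q <#>\<^bsub>G\<^esub> R) G" "finite (Q <#>\<^bsub>G\<^esub> R)"
  shows "trace_sum G M (Q <#>\<^bsub>G\<^esub> R) = trace_sum G M Q"
proof -
  define H where "H = Q <#>\<^bsub>G\<^esub> R"
  have sR: "subgroup R G" and sH: "subgroup H G"
    using R(1) QR(1) normal_imp_subgroup by (auto simp: p_subgroup_def H_def)
  have one: "\<one>\<^bsub>G\<^esub> \<in> R" "\<one>\<^bsub>G\<^esub> \<in> Q" using sR Q subgroup.one_closed by auto
  have sub: "Q \<subseteq> carrier G" "R \<subseteq> carrier G" "H \<subseteq> carrier G"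
    using Q sR sH subgroup.subset by blast+
  have prodI: "K \<subseteq> K <#>\<^bsub>G\<^esub> R" "R \<subseteq> K <#>\<^bsub>G\<^esub> R" if "subgroup K G" for K
    using one(1) subgroup.one_closed[OF that] subgroup.subset[OF that] sub(2)
    by (force simp: set_mult_def)+
  have QH: "Q \<subseteq> H" "R \<subseteq> H" using prodI[OF Q] by (auto simp: H_def)
  have prod_subset: "A <#>\<^bsub>G\<^esub> B \<subseteq> C" if "A \<subseteq> C" "B \<subseteq> C" "subgroup C G" for A B C
    using that subgroup.m_closed[OF that(3)] by (auto simp: set_mult_def)
  have finH: "finite H" "finite Q"
    using QR(2) QH finite_subset by (auto simp: H_def)
  have pQ: "p_subgroup p Q G" and pH: "p_subgroup p H G"
    using G.p_subgroup_subset[OF QR(1) p(2) Q] QH QR(1) by (auto simp: H_def)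
  have prodR: "subgroup (K <#>\<^bsub>G\<^esub> R) G" if "subgroup K G" for K
    using G.mult_norm_subgroup[OF R(1) that] G.commut_normal[OF that R(1)] by simp
  have fixR: "fixed_points M (K <#>\<^bsub>G\<^esub> R) = fixed_points M K" if "subgroup K G" for K
    using fixed_points_set_mult_kernel[OF subgroup.subset[OF that] R(2) one(1)] .
  have "trace_sum G M Q \<subseteq> trace_sum G M H"
  proof (rule trace_sum_least)
    show sm: "submodule (trace_sum G M H) k M"
      by (rule trace_sum_submodule) (use finH sub in auto)
    fix K m assume K: "K \<in> proper_subgroups G Q" and m: "m \<in> fixed_points M K"
    have sK: "subgroup K G" "K \<subset> Q" using K by (auto simp: proper_subgroups_def)
    define L where "L = K <#>\<^bsub>G\<^esub> R"
    have sL: "subgroup L G" and mL: "m \<in> fixed_points M L"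
      using prodR[OF sK(1)] fixR[OF sK(1)] m by (auto simp: L_def)
    have LH: "L \<subseteq> H"
      unfolding L_def using prod_subset[OF _ QH(2) sH, of K] sK(2) QH by auto
    show "rel_trace G M K Q m \<in> trace_sum G M H"
    proof (cases "L = H")
      case True
      then have "m \<in> fixed_points M Q" using mL QH by (auto simp: fixed_points_def)
      then have "rel_trace G M K Q m = \<zero>\<^bsub>M\<^esub>"
        using rel_trace_of_fixed_eq_zero[OF p pQ finH(2) sK] by simp
      then show ?thesis
        using submodule_zero_closed[OF sm] by simp
    next
      case False
      then have L: "L \<in> proper_subgroups G H" using LH sL by (auto simp: proper_subgroups_def)
      \<comment> \<open>As \<open>R\<close> lies in \<open>L\<close>, the equation
        \<open>H = QR\<close> gives \<open>H = QL\<close>, as the comparison of traces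
        requires.\<close>
      have "H = Q <#>\<^bsub>G\<^esub> L"
      proof
        show "H \<subseteq> Q <#>\<^bsub>G\<^esub> L"
          unfolding H_def using prodI(2)[OF sK(1)] by (intro mono_set_mult) (auto simp: L_def)
      qed (use prod_subset[OF QH(1) LH sH] in auto)
      then have "rel_trace G M K Q m =
          ([card ((\<lambda>h. h <#\<^bsub>G\<^esub> K) ` (Q \<inter> L))] \<cdot> \<one>) \<odot>\<^bsub>M\<^esub> rel_trace G M L H m"
        using sK sL Q sH finH mL prodI(1)[OF sK(1)] by (intro rel_trace_compare) (auto simp: L_def)
      then show ?thesis
        using trace_sumI[OF finH(1) sub(3) L mL] submoduleE(4)[OF sm] by simp
    qed
  qed
  moreover have "trace_sum G M H \<subseteq> trace_sum G M Q"
  proof (rule trace_sum_least)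
    show sm: "submodule (trace_sum G M Q) k M"
      by (rule trace_sum_submodule) (use finH sub in auto)
    fix K m assume K: "K \<in> proper_subgroups G H" and m: "m \<in> fixed_points M K"
    have sK: "subgroup K G" "K \<subset> H" using K by (auto simp: proper_subgroups_def)
    define L where "L = K <#>\<^bsub>G\<^esub> R"
    have sL: "subgroup L G" and mL: "m \<in> fixed_points M L"
      using prodR[OF sK(1)] fixR[OF sK(1)] m by (auto simp: L_def)
    have LH: "L \<subseteq> H"
      unfolding L_def using prod_subset[OF _ QH(2) sH, of K] sK(2) by auto
    show "rel_trace G M K H m \<in> trace_sum G M Q"
    proof (cases "L = H")
      case True
      then have "rel_trace G M K H m = \<zero>\<^bsub>M\<^esub>"
        using rel_trace_of_fixed_eq_zero[OF p pH finH(1) sK] mL by simp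
      then show ?thesis
        using submodule_zero_closed[OF sm] by simp
    next
      case False
      \<comment> \<open>The subgroup of \<open>Q\<close> whose trace replaces the one from
        \<open>L\<close> to \<open>H\<close>. It is proper, since otherwise \<open>Q\<close> and
        \<open>R\<close> would both lie in \<open>L\<close>, giving \<open>L = H\<close>.\<close>
      define J where "J = Q \<inter> L"
      have sJ: "subgroup J G" unfolding J_def by (rule G.subgroups_Inter_pair[OF Q sL])
      have mJ: "m \<in> fixed_points M J" using mL by (auto simp: fixed_points_def J_def)
      have RL: "R \<subseteq> L" using prodI(2)[OF sK(1)] by (simp add: L_def)
      have "\<not> Q \<subseteq> L"
        using prod_subset[OF _ RL sL, of Q] LH False by (auto simp: H_def)
      then have J: "J \<in> proper_subgroups G Q" using sJ by (auto simp: proper_subgroups_def J_def)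
      have H1: "H = H <#>\<^bsub>G\<^esub> L"
        using prod_subset[OF _ LH sH, of H] subgroup.one_closed[OF sL] sub(3)
        by (force simp: set_mult_def)
      have H2: "H = Q <#>\<^bsub>G\<^esub> L"
      proof
        show "H \<subseteq> Q <#>\<^bsub>G\<^esub> L"
          unfolding H_def using RL by (intro mono_set_mult) auto
      qed (use prod_subset[OF QH(1) LH sH] in auto)
      \<comment> \<open>The intersection of \<open>Q\<close> and \<open>L\<close> is
        \<open>J\<close>, so the coefficient in the comparison is 1 and the two traces agree on
        \<open>m\<close>.\<close>
      have "(\<lambda>h. h <#\<^bsub>G\<^esub> J) ` (Q \<inter> L) = {J}"
        using G.coset_join3[OF _ sJ] subgroup.subset[OF sJ] subgroup.one_closed[OF sJ]
        unfolding J_def[symmetric] by blast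
      then have "rel_trace G M J Q m = rel_trace G M L H m"
        using rel_trace_compare[OF sJ sL Q sH _ _ finH(1) H2 mL]
          rel_trace_closed[OF sL sub(3) mL] by (simp add: J_def)
      \<comment> \<open>The comparison is now used with \<open>H\<close> in the place of
        \<open>Q\<close>; the coefficient is the index of \<open>K\<close> in
        \<open>L\<close>.\<close>
      then have "rel_trace G M K H m =
          ([card ((\<lambda>h. h <#\<^bsub>G\<^esub> K) ` (H \<inter> L))] \<cdot> \<one>) \<odot>\<^bsub>M\<^esub> rel_trace G M J Q m"
        using rel_trace_compare[OF sK(1) sL sH sH _ _ finH(1) H1 mL] sK(2) prodI(1)[OF sK(1)]
        by (simp add: L_def)
      then show ?thesis
        using trace_sumI[OF finH(2) sub(1) J mJ] submoduleE(4)[OF sm] by simp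
    qed
  qed
  ultimately show ?thesis by (simp add: H_def)
qed

text \<open>Numerator and denominator are the same sets for both subgroups, so the quotients are
  equal and not merely isomorphic; no transport of indecomposability along an isomorphism
  arises.\<close>

lemma Brauer_set_mult_kernel:
  assumes "ring_char k = p" "Factorial_Ring.prime p"
    and "subgroup Q G" "R \<lhd> G" "R \<subseteq> module_kernel G M"
    and "p_subgroup p (Q <#>\<^bsub>G\<^esub> R) G" "finite (Q <#>\<^bsub>G\<^esub> R)"
  shows "Brauer G M (Q <#>\<^bsub>G\<^esub> R) = Brauer G M Q"
proof -
  have "\<one>\<^bsub>G\<^esub> \<in> R" using assms(4) normal_imp_subgroup subgroup.one_closed by blast
  then have "fixed_points M (Q <#>\<^bsub>G\<^esub> R) = fixed_points M Q"
    by (rule fixed_points_set_mult_kernel[OF subgroup.subset[OF assms(3)] assms(5)])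
  then show ?thesis
    unfolding Brauer_def trace_sum_set_mult_kernel[OF assms] by simp
qed

end

section \<open>Induced modules\<close>

text \<open>\<open>Brauer\<close> takes cosets in \<open>M\<close> with its carrier replaced by
  fixed points; cosets depend only on the addition.\<close>

lemma a_r_coset_carrier_update [simp]: "N +>\<^bsub>M\<lparr>carrier := F\<rparr>\<^esub> x = N +>\<^bsub>M\<^esub> x"
  by (simp add: a_r_coset_def')

context kG_module
begin

section \<open>Quotient modules\<close>

lemma submodule_additive: "submodule N k M \<Longrightarrow> abelian_subgroup N M"
  by (rule abelian_subgroupI3)
    (auto intro: additive_subgroupI submodule.axioms(1) M.abelian_group_axioms)

lemma coset_eq_iff:
  assumes "submodule N k M" "x \<in> carrier M" "y \<in> carrier M"
  shows "N +>\<^bsub>M\<^esub> x = N +>\<^bsub>M\<^esub> y \<longleftrightarrow> x \<ominus>\<^bsub>M\<^esub> y \<in> N"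
proof -
  interpret N: abelian_subgroup N M by (rule submodule_additive[OF assms(1)])
  show ?thesis
    using N.a_rcos_module[OF assms(3,2)] N.a_rcos_self[OF assms(2)]
      M.a_repr_independence[OF _ assms(3) N.a_subgroup, of x]
    by (auto simp: a_minus_def)
qed

lemma act_minus:
  assumes "g \<in> carrier G" "x \<in> carrier M" "y \<in> carrier M"
  shows "act M g (x \<ominus>\<^bsub>M\<^esub> y) = act M g x \<ominus>\<^bsub>M\<^esub> act M g y"
proof -
  have "act M g (\<ominus>\<^bsub>M\<^esub> y) = \<ominus>\<^bsub>M\<^esub> act M g y"
    using act_smult[of g "\<ominus> \<one>" y] assms by (simp add: smult_l_minus act_closed)
  then show ?thesis using assms by (simp add: a_minus_def act_add)
qed

text \<open>Representatives of one coset differ by an element of \<open>N\<close>. Since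
  \<open>N\<close> is stable under scalars and under \<open>G\<close>, all members of the unions in
  \<open>quotient_module\<close> coincide, and the operations can be computed on any
  representative.\<close>

lemma quotient_simps:
  assumes N: "gsubmodule k G M N"
  shows "carrier (quotient_module M N) = (\<lambda>x. N +>\<^bsub>M\<^esub> x) ` carrier M"
    and "zero (quotient_module M N) = N +>\<^bsub>M\<^esub> \<zero>\<^bsub>M\<^esub>"
    and "\<lbrakk>x \<in> carrier M; y \<in> carrier M\<rbrakk> \<Longrightarrow>
      add (quotient_module M N) (N +>\<^bsub>M\<^esub> x) (N +>\<^bsub>M\<^esub> y) = N +>\<^bsub>M\<^esub> (x \<oplus>\<^bsub>M\<^esub> y)"
    and "\<lbrakk>c \<in> carrier k; x \<in> carrier M\<rbrakk> \<Longrightarrow>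
      c \<odot>\<^bsub>quotient_module M N\<^esub> (N +>\<^bsub>M\<^esub> x) = N +>\<^bsub>M\<^esub> (c \<odot>\<^bsub>M\<^esub> x)"
    and "\<lbrakk>g \<in> carrier G; x \<in> carrier M\<rbrakk> \<Longrightarrow>
      act (quotient_module M N) g (N +>\<^bsub>M\<^esub> x) = N +>\<^bsub>M\<^esub> act M g x"
proof -
  have sN: "submodule N k M" and gN: "\<And>g u. \<lbrakk>g \<in> carrier G; u \<in> N\<rbrakk> \<Longrightarrow> act M g u \<in> N"
    using N by (auto simp: gsubmodule_def)
  interpret N: abelian_subgroup N M by (rule submodule_additive[OF sN])
  have self: "x \<in> N +>\<^bsub>M\<^esub> x" if "x \<in> carrier M" for x using N.a_rcos_self that .
  have rep: "y \<in> carrier M" "y \<ominus>\<^bsub>M\<^esub> x \<in> N" if "y \<in> N +>\<^bsub>M\<^esub> x" "x \<in> carrier M" for x y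
  proof -
    show y: "y \<in> carrier M"
      using that N.a_elemrcos_carrier M.abelian_group_axioms by blast
    show "y \<ominus>\<^bsub>M\<^esub> x \<in> N"
      using that N.a_rcos_module[OF that(2) y] by (simp add: a_minus_def)
  qed
  show "carrier (quotient_module M N) = (\<lambda>x. N +>\<^bsub>M\<^esub> x) ` carrier M"
    by (auto simp: quotient_module_def A_RCOSETS_def')
  show "zero (quotient_module M N) = N +>\<^bsub>M\<^esub> \<zero>\<^bsub>M\<^esub>"
    using N.a_subset by (auto simp: quotient_module_def)
  show "add (quotient_module M N) (N +>\<^bsub>M\<^esub> x) (N +>\<^bsub>M\<^esub> y) = N +>\<^bsub>M\<^esub> (x \<oplus>\<^bsub>M\<^esub> y)"
    if "x \<in> carrier M" "y \<in> carrier M"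
    using that by (simp add: quotient_module_def N.a_rcos_sum)
  show "c \<odot>\<^bsub>quotient_module M N\<^esub> (N +>\<^bsub>M\<^esub> x) = N +>\<^bsub>M\<^esub> (c \<odot>\<^bsub>M\<^esub> x)"
    if c: "c \<in> carrier k" and x: "x \<in> carrier M"
  proof -
    have eq: "N +>\<^bsub>M\<^esub> (c \<odot>\<^bsub>M\<^esub> y) = N +>\<^bsub>M\<^esub> (c \<odot>\<^bsub>M\<^esub> x)" if "y \<in> N +>\<^bsub>M\<^esub> x" for y
    proof -
      have "c \<odot>\<^bsub>M\<^esub> y \<ominus>\<^bsub>M\<^esub> c \<odot>\<^bsub>M\<^esub> x = c \<odot>\<^bsub>M\<^esub> (y \<ominus>\<^bsub>M\<^esub> x)"
        using c x rep[OF that x] by (simp add: a_minus_def smult_r_distr smult_r_minus)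
      then show ?thesis
        using c x rep[OF that x] submoduleE(4)[OF sN] by (simp add: coset_eq_iff[OF sN])
    qed
    have "(\<Union>y\<in>N +>\<^bsub>M\<^esub> x. N +>\<^bsub>M\<^esub> (c \<odot>\<^bsub>M\<^esub> y)) = (\<Union>y\<in>N +>\<^bsub>M\<^esub> x. N +>\<^bsub>M\<^esub> (c \<odot>\<^bsub>M\<^esub> x))"
      by (rule SUP_cong[OF refl eq])
    also have "\<dots> = N +>\<^bsub>M\<^esub> (c \<odot>\<^bsub>M\<^esub> x)" using self[OF x] by (subst UN_constant) auto
    finally show ?thesis by (simp add: quotient_module_def)
  qed
  show "act (quotient_module M N) g (N +>\<^bsub>M\<^esub> x) = N +>\<^bsub>M\<^esub> act M g x"
    if g: "g \<in> carrier G" and x: "x \<in> carrier M"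
  proof -
    have eq: "N +>\<^bsub>M\<^esub> act M g y = N +>\<^bsub>M\<^esub> act M g x" if "y \<in> N +>\<^bsub>M\<^esub> x" for y
      using g x rep[OF that x] gN by (simp add: coset_eq_iff[OF sN] act_closed act_minus[symmetric])
    have "(\<Union>y\<in>N +>\<^bsub>M\<^esub> x. N +>\<^bsub>M\<^esub> (act M g y)) = (\<Union>y\<in>N +>\<^bsub>M\<^esub> x. N +>\<^bsub>M\<^esub> (act M g x))"
      by (rule SUP_cong[OF refl eq])
    also have "\<dots> = N +>\<^bsub>M\<^esub> (act M g x)" using self[OF x] by (subst UN_constant) auto
    finally show ?thesis by (simp add: quotient_module_def)
  qed
qed

lemma quotient_kG_module:
  assumes N: "gsubmodule k G M N"
  shows "kG_module k G (quotient_module M N)"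
proof -
  note simps = quotient_simps[OF N]
  have "module k (quotient_module M N)"
  proof (rule moduleI)
    show "abelian_group (quotient_module M N)"
    proof (rule abelian_groupI)
      fix A assume "A \<in> carrier (quotient_module M N)"
      then obtain x where x: "x \<in> carrier M" "A = N +>\<^bsub>M\<^esub> x" by (auto simp: simps)
      then have "(N +>\<^bsub>M\<^esub> (\<ominus>\<^bsub>M\<^esub> x)) \<oplus>\<^bsub>quotient_module M N\<^esub> A = \<zero>\<^bsub>quotient_module M N\<^esub>"
        by (simp add: simps M.l_neg)
      then show "\<exists>B\<in>carrier (quotient_module M N).
          B \<oplus>\<^bsub>quotient_module M N\<^esub> A = \<zero>\<^bsub>quotient_module M N\<^esub>"
        using x by (auto simp: simps)
    qed (auto simp: simps M.a_ac)
  qed (auto simp: simps R.cring_axioms smult_l_distr smult_r_distr smult_assoc1)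
  moreover have "kG_module_axioms k G (quotient_module M N)"
    by unfold_locales (auto simp: simps act_closed act_add act_smult act_one act_mult)
  ultimately show ?thesis
    by (simp add: kG_module_def G.group_axioms)
qed

end

section \<open>Functions on the group as the tensor product of \<open>kG\<close> with
  \<open>N\<close>\<close>

lemma tensor_kG_simps:
  "a \<in> carrier (tensor_kG G N) \<longleftrightarrow>
    (\<forall>x\<in>carrier G. a x \<in> carrier N) \<and> a \<in> extensional (carrier G)"
  "zero (tensor_kG G N) = (\<lambda>x\<in>carrier G. \<zero>\<^bsub>N\<^esub>)"
  "add (tensor_kG G N) a b = (\<lambda>x\<in>carrier G. a x \<oplus>\<^bsub>N\<^esub> b x)"
  "c \<odot>\<^bsub>tensor_kG G N\<^esub> a = (\<lambda>x\<in>carrier G. c \<odot>\<^bsub>N\<^esub> a x)"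
  "act (tensor_kG G N) g a = (\<lambda>x\<in>carrier G. a (inv\<^bsub>G\<^esub> g \<otimes>\<^bsub>G\<^esub> x))"
  by (simp_all add: tensor_kG_def PiE_iff)

lemma tensor_kG_module:
  assumes "module k N" "group G"
  shows "kG_module k G (tensor_kG G N)"
proof -
  interpret N: module k N by fact
  interpret G: group G by fact
  have "module k (tensor_kG G N)"
  proof (rule moduleI)
    show "abelian_group (tensor_kG G N)"
    proof (rule abelian_groupI)
      fix a assume a: "a \<in> carrier (tensor_kG G N)"
      then have "(\<lambda>x\<in>carrier G. \<ominus>\<^bsub>N\<^esub> a x) \<oplus>\<^bsub>tensor_kG G N\<^esub> a = \<zero>\<^bsub>tensor_kG G N\<^esub>"
        by (auto simp: tensor_kG_simps N.M.l_neg intro!: restrict_ext)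
      then show "\<exists>b\<in>carrier (tensor_kG G N). b \<oplus>\<^bsub>tensor_kG G N\<^esub> a = \<zero>\<^bsub>tensor_kG G N\<^esub>"
        using a by (intro bexI[where x = "\<lambda>x\<in>carrier G. \<ominus>\<^bsub>N\<^esub> a x"])
          (auto simp: tensor_kG_simps(1))
    next
      fix a assume "a \<in> carrier (tensor_kG G N)"
      then show "\<zero>\<^bsub>tensor_kG G N\<^esub> \<oplus>\<^bsub>tensor_kG G N\<^esub> a = a"
        by (intro extensionalityI[where A = "carrier G"]) (auto simp: tensor_kG_simps)
    qed (auto simp: tensor_kG_simps N.M.a_ac intro!: restrict_ext)
  next
    fix a assume "a \<in> carrier (tensor_kG G N)"
    then show "\<one>\<^bsub>k\<^esub> \<odot>\<^bsub>tensor_kG G N\<^esub> a = a"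
      by (intro extensionalityI[where A = "carrier G"]) (auto simp: tensor_kG_simps)
  qed (auto simp: tensor_kG_simps N.R.cring_axioms N.smult_l_distr N.smult_r_distr N.smult_assoc1
      intro!: restrict_ext)
  moreover have "kG_module_axioms k G (tensor_kG G N)"
  proof
    fix a assume "a \<in> carrier (tensor_kG G N)"
    then show "act (tensor_kG G N) \<one>\<^bsub>G\<^esub> a = a"
      by (intro extensionalityI[where A = "carrier G"]) (auto simp: tensor_kG_simps)
  qed (auto simp: tensor_kG_simps G.inv_mult_group G.m_assoc intro!: restrict_ext)
  ultimately show ?thesis
    by (simp add: kG_module_def G.group_axioms)
qed

lemma pure_tensor_closed:
  assumes "module k N" "n \<in> carrier N"
  shows "pure_tensor G N g n \<in> carrier (tensor_kG G N)"
proof -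
  interpret N: module k N by fact
  show ?thesis using assms(2) by (auto simp: pure_tensor_def tensor_kG_simps)
qed

text \<open>Shifting the argument by \<open>inv g\<close> moves the support from \<open>h\<close> to
  \<open>g \<otimes> h\<close>.\<close>

lemma (in group) act_pure_tensor:
  assumes "g \<in> carrier G" "h \<in> carrier G"
  shows "act (tensor_kG G N) g (pure_tensor G N h n) = pure_tensor G N (g \<otimes> h) n"
proof -
  have "inv g \<otimes> x = h \<longleftrightarrow> x = g \<otimes> h" if "x \<in> carrier G" for x
    using that assms by (metis inv_solve_left)
  then show ?thesis
    using assms by (auto simp: tensor_kG_simps pure_tensor_def intro!: restrict_ext)
qed

lemma tensor_kG_generated:
  assumes N: "module k N" and G: "group G" "finite (carrier G)"
    and S: "submodule S k (tensor_kG G N)"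
    and pure: "\<And>g n. \<lbrakk>g \<in> carrier G; n \<in> carrier N\<rbrakk> \<Longrightarrow> pure_tensor G N g n \<in> S"
  shows "carrier (tensor_kG G N) \<subseteq> S"
proof
  interpret N: module k N by fact
  interpret T: kG_module k G "tensor_kG G N" by (rule tensor_kG_module[OF N G(1)])
  fix a assume a: "a \<in> carrier (tensor_kG G N)"
  \<comment> \<open>The truncation of \<open>a\<close> to \<open>F\<close> grows by one pure tensor
    when a point is added to \<open>F\<close>; the choice of all of \<open>G\<close> for
    \<open>F\<close> returns \<open>a\<close>.\<close>
  have "(\<lambda>x\<in>carrier G. if x \<in> F then a x else \<zero>\<^bsub>N\<^esub>) \<in> S" if "finite F" "F \<subseteq> carrier G" for F
    using that
  proof (induct F)
    case empty
    then show ?case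
      using T.submodule_zero_closed[OF S] by (simp only: tensor_kG_simps empty_iff if_False)
  next
    case (insert g F)
    have an: "a x \<in> carrier N" if "x \<in> carrier G" for x
      using a that by (auto simp: tensor_kG_simps)
    have eq: "(\<lambda>x\<in>carrier G. if x \<in> insert g F then a x else \<zero>\<^bsub>N\<^esub>) =
        pure_tensor G N g (a g) \<oplus>\<^bsub>tensor_kG G N\<^esub> (\<lambda>x\<in>carrier G. if x \<in> F then a x else \<zero>\<^bsub>N\<^esub>)"
      using insert(2) an by (auto simp: tensor_kG_simps pure_tensor_def intro!: restrict_ext)
    show ?case
      unfolding eq
    proof (rule T.submoduleE(5)[OF S])
      show "pure_tensor G N g (a g) \<in> S" using insert(4) by (intro pure an) auto
      show "(\<lambda>x\<in>carrier G. if x \<in> F then a x else \<zero>\<^bsub>N\<^esub>) \<in> S"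
        using insert(4) by (intro insert(3)) auto
    qed
  qed
  from this[OF G(2)] have "restrict a (carrier G) \<in> S"
    by (simp cong: restrict_cong)
  then show "a \<in> S" using a by (simp add: tensor_kG_simps extensional_restrict)
qed

section \<open>The induced module and its generators\<close>

definition Ind_relations ::
  "('k, 'r) ring_scheme \<Rightarrow> ('g, 'h) monoid_scheme \<Rightarrow> 'g set \<Rightarrow> ('k, 'n, 'g) gmodule \<Rightarrow> ('g \<Rightarrow> 'n) set"
  where "Ind_relations k G H N =
    \<Inter>{S. submodule S k (tensor_kG G N) \<and> tensor_relations G H N \<subseteq> S}"

lemma Ind_eq: "Ind k G H N = quotient_module (tensor_kG G N) (Ind_relations k G H N)"
  by (simp add: Ind_def Ind_relations_def)

locale induced = N: kG_module k "G\<lparr>carrier := H\<rparr>" N + G?: group G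
  for k :: "('k, 'r) ring_scheme" and G :: "('g, 'h) monoid_scheme" (structure)
    and H :: "'g set" and N :: "('k, 'n, 'g) gmodule" +
  assumes H: "subgroup H G" and finite_G: "finite (carrier G)"
begin

sublocale T: kG_module k G "tensor_kG G N"
  by (rule tensor_kG_module) unfold_locales

abbreviation "S \<equiv> Ind_relations k G H N"

lemma relations_subset: "tensor_relations G H N \<subseteq> S"
  by (auto simp: Ind_relations_def)

lemma relations_subset_carrier: "tensor_relations G H N \<subseteq> carrier (tensor_kG G N)"
  using pure_tensor_closed[OF N.module_axioms] N.act_closed
  by (auto simp: tensor_relations_def intro!: T.M.minus_closed)

lemma submodule_S: "submodule S k (tensor_kG G N)"
proof (rule T.submodule_smultI)
  show "S \<subseteq> carrier (tensor_kG G N)"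
    \<comment> \<open>The whole tensor module is one of the submodules being intersected.\<close>
    using T.carrier_is_submodule relations_subset_carrier by (auto simp: Ind_relations_def)
  show "\<zero>\<^bsub>tensor_kG G N\<^esub> \<in> S"
    using T.submodule_zero_closed by (auto simp: Ind_relations_def)
qed (use T.submoduleE(4,5) in \<open>auto simp: Ind_relations_def\<close>)

text \<open>For fixed \<open>g\<close>, the elements sent into \<open>S\<close> by \<open>g\<close>
  form a submodule \<open>?W\<close>. It contains the relations, because \<open>g\<close> turns the
  relation for \<open>x\<close>, \<open>h\<close>, \<open>n\<close> into the one for
  \<open>g \<otimes> x\<close>, \<open>h\<close>, \<open>n\<close>. Minimality of \<open>S\<close>
  then gives \<open>S \<subseteq> ?W\<close>.\<close>

lemma gsubmodule_S: "gsubmodule k G (tensor_kG G N) S"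
  unfolding gsubmodule_def
proof (intro conjI ballI submodule_S)
  fix g s assume g: "g \<in> carrier G" and s: "s \<in> S"
  let ?W = "{t \<in> carrier (tensor_kG G N). act (tensor_kG G N) g t \<in> S}"
  have "submodule ?W k (tensor_kG G N)"
  proof (rule T.submodule_smultI)
    have "act (tensor_kG G N) g \<zero>\<^bsub>tensor_kG G N\<^esub> = \<zero>\<^bsub>tensor_kG G N\<^esub>"
      using g by (auto simp: tensor_kG_simps intro!: restrict_ext)
    then show "\<zero>\<^bsub>tensor_kG G N\<^esub> \<in> ?W"
      using T.submodule_zero_closed[OF submodule_S] by simp
  qed (use g T.submoduleE(4,5)[OF submodule_S] in \<open>auto simp: T.act_add T.act_smult\<close>)
  moreover have "tensor_relations G H N \<subseteq> ?W"
  proof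
    fix t assume t: "t \<in> tensor_relations G H N"
    then obtain x h n where x: "x \<in> carrier G" "h \<in> H" "n \<in> carrier N" and
      t_eq: "t = pure_tensor G N (x \<otimes> h) n \<ominus>\<^bsub>tensor_kG G N\<^esub> pure_tensor G N x (act N h n)"
      by (auto simp: tensor_relations_def)
    have h: "h \<in> carrier G" using x(2) subgroup.subset[OF H] by blast
    have "act N h n \<in> carrier N" using N.act_closed x by simp
    then have "act (tensor_kG G N) g t =
        pure_tensor G N ((g \<otimes> x) \<otimes> h) n \<ominus>\<^bsub>tensor_kG G N\<^esub> pure_tensor G N (g \<otimes> x) (act N h n)"
      unfolding t_eq using g x h
      by (simp add: T.act_minus pure_tensor_closed[OF N.module_axioms] act_pure_tensor m_assoc)
    then have "act (tensor_kG G N) g t \<in> tensor_relations G H N"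
      using g x by (auto simp: tensor_relations_def)
    then show "t \<in> ?W" using t relations_subset relations_subset_carrier by auto
  qed
  ultimately have "S \<subseteq> ?W" by (auto simp: Ind_relations_def)
  then show "act (tensor_kG G N) g s \<in> S" using s by auto
qed

sublocale I: kG_module k G "Ind k G H N"
  unfolding Ind_eq by (rule T.quotient_kG_module[OF gsubmodule_S])

text \<open>The unit of the adjunction between induction and restriction.\<close>

definition unit :: "'n \<Rightarrow> ('g \<Rightarrow> 'n) set" where
  "unit n = S +>\<^bsub>tensor_kG G N\<^esub> pure_tensor G N \<one> n"

lemmas Ind_simps = T.quotient_simps[OF gsubmodule_S, folded Ind_eq]

lemma unit_closed: "n \<in> carrier N \<Longrightarrow> unit n \<in> carrier (Ind k G H N)"
  by (auto simp: unit_def Ind_simps(1) pure_tensor_closed[OF N.module_axioms])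

lemma act_unit:
  assumes "g \<in> carrier G" "n \<in> carrier N"
  shows "act (Ind k G H N) g (unit n) = S +>\<^bsub>tensor_kG G N\<^esub> pure_tensor G N g n"
  using assms by (simp add: unit_def Ind_simps(5) pure_tensor_closed[OF N.module_axioms] act_pure_tensor)

text \<open>This is the defining relation of the induced module at
  \<open>g = \<one>\<close>.\<close>

lemma act_unit_subgroup:
  assumes "h \<in> H" "n \<in> carrier N"
  shows "act (Ind k G H N) h (unit n) = unit (act N h n)"
proof -
  have h: "h \<in> carrier G" using assms(1) subgroup.subset[OF H] by blast
  have "act N h n \<in> carrier N" using N.act_closed assms by simp
  moreover have "pure_tensor G N (\<one> \<otimes> h) n \<ominus>\<^bsub>tensor_kG G N\<^esub> pure_tensor G N \<one> (act N h n) \<in> S"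
    using relations_subset assms one_closed unfolding tensor_relations_def by blast
  ultimately show ?thesis
    using assms h act_unit[OF h assms(2)]
    by (simp add: unit_def T.coset_eq_iff[OF submodule_S] pure_tensor_closed[OF N.module_axioms])
qed

text \<open>The preimage of \<open>W\<close> in the tensor module contains every pure tensor, since
  the class of the one at \<open>g\<close> is the translate of \<open>unit n\<close> by
  \<open>g\<close>. Hence this preimage is everything.\<close>

lemma Ind_generated:
  assumes W: "gsubmodule k G (Ind k G H N) W" and unit: "\<And>n. n \<in> carrier N \<Longrightarrow> unit n \<in> W"
  shows "W = carrier (Ind k G H N)"
proof
  have sW: "submodule W k (Ind k G H N)" and gW: "\<And>g w. \<lbrakk>g \<in> carrier G; w \<in> W\<rbrakk> \<Longrightarrow> act (Ind k G H N) g w \<in> W"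
    using W by (auto simp: gsubmodule_def)
  show "W \<subseteq> carrier (Ind k G H N)" by (rule I.submoduleE(1)[OF sW])
  let ?V = "{t \<in> carrier (tensor_kG G N). S +>\<^bsub>tensor_kG G N\<^esub> t \<in> W}"
  have "carrier (tensor_kG G N) \<subseteq> ?V"
  proof (rule tensor_kG_generated[OF N.module_axioms group_axioms finite_G])
    show "submodule ?V k (tensor_kG G N)"
    proof (rule T.submodule_smultI)
      show "\<zero>\<^bsub>tensor_kG G N\<^esub> \<in> ?V"
        using I.submodule_zero_closed[OF sW] by (simp add: Ind_simps(2))
    qed (use I.submoduleE(4,5)[OF sW] in \<open>auto simp: Ind_simps(3,4)[symmetric]\<close>)
    show "pure_tensor G N g n \<in> ?V" if "g \<in> carrier G" "n \<in> carrier N" for g n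
      using gW[OF that(1) unit[OF that(2)]] that act_unit pure_tensor_closed[OF N.module_axioms] by auto
  qed
  then show "carrier (Ind k G H N) \<subseteq> W" by (auto simp: Ind_simps(1))
qed

end

section \<open>Scott modules\<close>

lemma trivial_module_simps [simp]:
  "carrier (trivial_module k) = carrier k"
  "zero (trivial_module k) = \<zero>\<^bsub>k\<^esub>"
  "add (trivial_module k) = add k"
  "smult (trivial_module k) = monoid.mult k"
  "act (trivial_module k) g x = x"
  by (simp_all add: trivial_module_def)

lemma trivial_kG_module:
  assumes "cring k" "group G"
  shows "kG_module k G (trivial_module k)"
proof -
  interpret R: cring k by fact
  have "module k (trivial_module k :: ('a, 'a, 'c) gmodule)"
  proof (rule moduleI)
    show "abelian_group (trivial_module k :: ('a, 'a, 'c) gmodule)"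
      by (rule abelian_groupI) (use R.add.l_inv_ex in \<open>auto simp: R.a_ac\<close>)
  qed (auto simp: R.cring_axioms R.l_distr R.r_distr R.m_assoc)
  then show ?thesis
    using assms(2) by (auto simp: kG_module_def kG_module_axioms_def)
qed

section \<open>Maps to the trivial module and nonvanishing of \<open>M(Q)\<close>\<close>

lemma kG_homD:
  assumes "f \<in> kG_hom k G M N"
  shows "x \<in> carrier M \<Longrightarrow> f x \<in> carrier N"
    and "\<lbrakk>x \<in> carrier M; y \<in> carrier M\<rbrakk> \<Longrightarrow> f (x \<oplus>\<^bsub>M\<^esub> y) = f x \<oplus>\<^bsub>N\<^esub> f y"
    and "\<lbrakk>c \<in> carrier k; x \<in> carrier M\<rbrakk> \<Longrightarrow> f (c \<odot>\<^bsub>M\<^esub> x) = c \<odot>\<^bsub>N\<^esub> f x"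
    and "\<lbrakk>g \<in> carrier G; x \<in> carrier M\<rbrakk> \<Longrightarrow> f (act M g x) = act N g (f x)"
  using assms by (auto simp: kG_hom_def)

context kG_module
begin

text \<open>The difference of the \<open>U\<close>-components is a difference of
  \<open>V\<close>-components, hence lies in both summands.\<close>

lemma direct_decomposition_unique:
  assumes "direct_decomposition k G M U V"
    and "u \<in> U" "u' \<in> U" "v \<in> V" "v' \<in> V"
    and eq: "u \<oplus>\<^bsub>M\<^esub> v = u' \<oplus>\<^bsub>M\<^esub> v'"
  shows "u = u'"
proof -
  have U: "submodule U k M" and V: "submodule V k M" and UV: "U \<inter> V = {\<zero>\<^bsub>M\<^esub>}"
    using assms(1) by (auto simp: direct_decomposition_def gsubmodule_def)
  have cl: "u \<in> carrier M" "u' \<in> carrier M" "v \<in> carrier M" "v' \<in> carrier M"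
    using assms(2-5) submoduleE(1)[OF U] submoduleE(1)[OF V] by auto
  have "u \<ominus>\<^bsub>M\<^esub> u' = u \<oplus>\<^bsub>M\<^esub> v \<ominus>\<^bsub>M\<^esub> v \<ominus>\<^bsub>M\<^esub> u'"
    using cl by (simp add: a_minus_def M.a_assoc M.r_neg)
  also have "\<dots> = v' \<ominus>\<^bsub>M\<^esub> v"
  proof -
    have "u' \<oplus>\<^bsub>M\<^esub> v' \<ominus>\<^bsub>M\<^esub> v \<ominus>\<^bsub>M\<^esub> u' = u' \<oplus>\<^bsub>M\<^esub> (\<ominus>\<^bsub>M\<^esub> u' \<oplus>\<^bsub>M\<^esub> (v' \<ominus>\<^bsub>M\<^esub> v))"
      using cl by (simp add: a_minus_def M.a_ac)
    then show ?thesis unfolding eq using cl by (simp add: M.r_neg2)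
  qed
  finally have "u \<ominus>\<^bsub>M\<^esub> u' = v' \<ominus>\<^bsub>M\<^esub> v" .
  moreover have "u \<ominus>\<^bsub>M\<^esub> u' \<in> U" "v' \<ominus>\<^bsub>M\<^esub> v \<in> V"
    using assms(2-5) submoduleE(3,5)[OF U] submoduleE(3,5)[OF V] by (auto simp: a_minus_def)
  ultimately have "u \<ominus>\<^bsub>M\<^esub> u' = \<zero>\<^bsub>M\<^esub>" using UV by auto
  then show ?thesis using cl M.minus_equality[of u "\<ominus>\<^bsub>M\<^esub> u'"] by (simp add: a_minus_def)
qed

text \<open>Every coset contributes the same value \<open>f m\<close>, as the target has trivial
  action; so a trace from \<open>K\<close> is sent to \<open>f m\<close> times the index of
  \<open>K\<close> in \<open>Q\<close>.\<close>

lemma trivial_hom_vanishes_on_trace_sum: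
  assumes f: "f \<in> kG_hom k G M (trivial_module k)"
    and p: "ring_char k = p" "Factorial_Ring.prime p"
    and Q: "p_subgroup p Q G" "finite Q"
    and m: "m \<in> trace_sum G M Q"
  shows "f m = \<zero>"
proof -
  note hom = kG_homD[OF f, simplified]
  have sQ: "subgroup Q G" using Q by (simp add: p_subgroup_def)
  have QG: "Q \<subseteq> carrier G" using subgroup.subset[OF sQ] .
  have f0: "f \<zero>\<^bsub>M\<^esub> = \<zero>"
    using hom(3)[of \<zero> "\<zero>\<^bsub>M\<^esub>"] hom(1) by simp
  have f_sum: "f (\<Oplus>\<^bsub>M\<^esub>i\<in>A. F i) = [card A] \<cdot> c"
    if "finite A" "\<And>i. i \<in> A \<Longrightarrow> F i \<in> carrier M" "\<And>i. i \<in> A \<Longrightarrow> f (F i) = c" "c \<in> carrier k"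
    for A :: "'b set set" and F c
    using that(1,2,3)
    by (induct A) (use that(4) in \<open>auto simp: f0 hom Pi_def R.a_comm\<close>)
  have "trace_sum G M Q \<subseteq> {m \<in> carrier M. f m = \<zero>}"
  proof (rule trace_sum_least)
    show "submodule {m \<in> carrier M. f m = \<zero>} k M"
      by (rule submodule_smultI) (auto simp: f0 hom)
    fix K m assume K: "K \<in> proper_subgroups G Q" and m: "m \<in> fixed_points M K"
    have sK: "subgroup K G" "K \<subset> Q" using K by (auto simp: proper_subgroups_def)
    let ?n = "card ((\<lambda>h. h <#\<^bsub>G\<^esub> K) ` Q)"
    have fm: "f m \<in> carrier k" using m hom(1) fixed_points_carrier by blast
    have "f (rel_trace G M K Q m) = [?n] \<cdot> f m"
      unfolding rel_trace_eq
    proof (rule f_sum)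
      fix C assume "C \<in> (\<lambda>h. h <#\<^bsub>G\<^esub> K) ` Q"
      then show "f (act M (SOME h. h \<in> C) m) = f m"
        using QG m sK(1) by (auto simp: act_coset_representative hom fixed_points_carrier subset_iff)
    qed (use act_representative_closed[OF sK(1) QG _ m] Q(2) fm in auto)
    also have "\<dots> = ([?n] \<cdot> \<one>) \<otimes> f m"
      using fm by (simp add: add_pow_ldistr)
    also have "[?n] \<cdot> \<one> = \<zero>"
      using G.p_subgroup_dvd_index[OF Q p(2) sK] p
      by (intro ring_char_dvd_imp) (auto simp: prime_gt_0_nat)
    finally show "rel_trace G M K Q m \<in> {m \<in> carrier M. f m = \<zero>}"
      using fm rel_trace_closed[OF sK(1) QG m] by simp
  qed
  then show ?thesis using m by auto
qed

text \<open>If the quotient were zero, \<open>x\<close> would lie in \<open>trace_sum\<close>, where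
  \<open>f\<close> vanishes.\<close>

lemma Brauer_nonzero:
  assumes f: "f \<in> kG_hom k G M (trivial_module k)"
    and p: "ring_char k = p" "Factorial_Ring.prime p"
    and Q: "p_subgroup p Q G" "finite Q"
    and x: "x \<in> fixed_points M Q" "f x \<noteq> \<zero>"
  shows "carrier (Brauer G M Q) \<noteq> {\<zero>\<^bsub>Brauer G M Q\<^esub>}"
proof
  let ?N = "trace_sum G M Q"
  have QG: "Q \<subseteq> carrier G" using Q subgroup.subset by (auto simp: p_subgroup_def)
  assume "carrier (Brauer G M Q) = {\<zero>\<^bsub>Brauer G M Q\<^esub>}"
  then have "?N +>\<^bsub>M\<^esub> x = ?N"
    using x(1) by (auto simp: Brauer_def quotient_module_def A_RCOSETS_def')
  moreover have "x \<in> ?N +>\<^bsub>M\<^esub> x"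
    using submodule_zero_closed[OF trace_sum_submodule[OF Q(2) QG]] fixed_points_carrier[OF x(1)]
    by (force simp: a_r_coset_def')
  ultimately show False
    using trivial_hom_vanishes_on_trace_sum[OF f p Q] x(2) by auto
qed

section \<open>Passing between the centralizer and its product with \<open>Q\<close>\<close>

lemma act_Brauer_mult:
  assumes Q: "subgroup Q G" "finite Q" and q: "q \<in> Q" and c: "c \<in> centralizer G Q"
    and A: "A \<in> carrier (Brauer G M Q)"
  shows "act (Brauer G M Q) (q \<otimes>\<^bsub>G\<^esub> c) A = act (Brauer G M Q) c A"
proof -
  have QG: "Q \<subseteq> carrier G" using Q subgroup.subset by blast
  have cG: "c \<in> carrier G" using c by (simp add: centralizer_def)
  obtain y where y: "y \<in> fixed_points M Q" "A = trace_sum G M Q +>\<^bsub>M\<^esub> y"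
    using A by (auto simp: Brauer_def quotient_module_def A_RCOSETS_def')
  \<comment> \<open>The action on \<open>A\<close> is a union over all its elements, so each of them
    must be fixed by \<open>q\<close>.\<close>
  have "A \<subseteq> fixed_points M Q"
    using y trace_sum_subset_fixed_points[OF Q] submoduleE(5)[OF fixed_points_submodule[OF QG]]
    by (auto simp: a_r_coset_def')
  then have "act M (q \<otimes>\<^bsub>G\<^esub> c) z = act M c z" if "z \<in> A" for z
  proof -
    have z: "z \<in> carrier M" "act M q z = z"
      using that \<open>A \<subseteq> fixed_points M Q\<close> q by (auto simp: fixed_points_def)
    have "act M (q \<otimes>\<^bsub>G\<^esub> c) z = act M (c \<otimes>\<^bsub>G\<^esub> q) z"
      using c q by (simp add: centralizer_def)
    also have "\<dots> = act M c z" using z cG q QG by (auto simp: act_mult)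
    finally show ?thesis .
  qed
  then show ?thesis by (simp add: Brauer_def quotient_module_def cong: SUP_cong)
qed

end

text \<open>Stability under more elements leaves fewer submodules, hence fewer
  decompositions.\<close>

lemma indecomposable_mono:
  assumes "indecomposable k (G\<lparr>carrier := H\<rparr>) M" "H \<subseteq> H'"
  shows "indecomposable k (G\<lparr>carrier := H'\<rparr>) M"
  using assms unfolding indecomposable_def direct_decomposition_def gsubmodule_def
  by (auto simp: subset_iff)

lemma (in group) centralizer_subset_mult:
  assumes "subgroup Q G"
  shows "centralizer G Q \<subseteq> Q <#>\<^bsub>G\<^esub> centralizer G Q"
  using subgroup.one_closed[OF assms] by (force simp: set_mult_def centralizer_def)

text \<open>A product of \<open>q \<in> Q\<close> and a centralizing \<open>c\<close> acts on
  \<open>M(Q)\<close> as \<open>c\<close> does, so both sets of operators have the same stable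
  submodules.\<close>

lemma (in kG_module) Brauer_indecomposable_centralizer_iff:
  assumes Q: "subgroup Q G" "finite Q"
  shows "indecomposable k (G\<lparr>carrier := Q <#>\<^bsub>G\<^esub> centralizer G Q\<rparr>) (Brauer G M Q) \<longleftrightarrow>
    indecomposable k (G\<lparr>carrier := centralizer G Q\<rparr>) (Brauer G M Q)"
proof -
  let ?B = "Brauer G M Q"
  have "gsubmodule k (G\<lparr>carrier := Q <#>\<^bsub>G\<^esub> centralizer G Q\<rparr>) ?B U \<longleftrightarrow>
      gsubmodule k (G\<lparr>carrier := centralizer G Q\<rparr>) ?B U" for U
  proof
    assume "gsubmodule k (G\<lparr>carrier := Q <#>\<^bsub>G\<^esub> centralizer G Q\<rparr>) ?B U"
    then show "gsubmodule k (G\<lparr>carrier := centralizer G Q\<rparr>) ?B U"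
      using G.centralizer_subset_mult[OF Q(1)] by (auto simp: gsubmodule_def)
  next
    assume U: "gsubmodule k (G\<lparr>carrier := centralizer G Q\<rparr>) ?B U"
    then have "U \<subseteq> carrier ?B"
      using subgroup.subset[OF submodule.axioms(1)] by (fastforce simp: gsubmodule_def)
    then show "gsubmodule k (G\<lparr>carrier := Q <#>\<^bsub>G\<^esub> centralizer G Q\<rparr>) ?B U"
      using U act_Brauer_mult[OF Q] by (auto simp: gsubmodule_def set_mult_def subset_iff)
  qed
  then show ?thesis by (simp add: indecomposable_def direct_decomposition_def)
qed

text \<open>If \<open>e = u + v\<close> is the decomposition of the generator of \<open>Ind\<close> along \<open>M \<oplus> V\<close>, then \<open>u\<close> is
  fixed by \<open>P\<close>, and a homomorphism killing \<open>u\<close> kills all of \<open>M\<close>.\<close>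

lemma Scott_module_fixed_point:
  assumes k: "field k" and "group G" "finite (carrier G)" and P: "subgroup P G"
    and M: "Scott_module k G P M"
  obtains f x where "f \<in> kG_hom k G M (trivial_module k)" "x \<in> fixed_points M P" "f x \<noteq> \<zero>\<^bsub>k\<^esub>"
proof -
  interpret R: field k by fact
  interpret G: group G by fact
  let ?T = "trivial_module k" and ?I = "Ind k G P (trivial_module k)"
  interpret D: induced k G P ?T
    unfolding induced_def induced_axioms_def
    using assms trivial_kG_module[OF R.cring_axioms subgroup.subgroup_is_group[OF P \<open>group G\<close>]] by simp
  interpret M: kG_module k G M using M by (simp add: Scott_module_def)
  obtain U V \<phi> f where UV: "direct_decomposition k G ?I U V"
    and \<phi>: "\<phi> \<in> kG_hom k G M (?I\<lparr>carrier := U\<rparr>)" "bij_betw \<phi> (carrier M) U"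
    and f: "f \<in> kG_hom k G M ?T" "f ` carrier M = carrier k"
    using M by (auto simp: Scott_module_def kG_isomorphic_def)
  have gU: "gsubmodule k G ?I U" and gV: "gsubmodule k G ?I V"
    and UV_eq: "U <+>\<^bsub>?I\<^esub> V = carrier ?I"
    using UV by (auto simp: direct_decomposition_def)
  have U: "submodule U k ?I" and V: "submodule V k ?I"
    and actU: "\<And>g u. \<lbrakk>g \<in> carrier G; u \<in> U\<rbrakk> \<Longrightarrow> act ?I g u \<in> U"
    and actV: "\<And>g v. \<lbrakk>g \<in> carrier G; v \<in> V\<rbrakk> \<Longrightarrow> act ?I g v \<in> V"
    using gU gV by (auto simp: gsubmodule_def)
  have Uc: "u \<in> carrier ?I" if "u \<in> U" for u using that D.I.submoduleE(1)[OF U] by blast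
  have Vc: "v \<in> carrier ?I" if "v \<in> V" for v using that D.I.submoduleE(1)[OF V] by blast
  note hom_f = kG_homD[OF f(1), simplified] and hom_\<phi> = kG_homD[OF \<phi>(1), simplified]
  note unique = D.I.direct_decomposition_unique[OF UV]
  let ?e = "D.unit \<one>\<^bsub>k\<^esub>"
  have "?e \<in> carrier ?I" by (simp add: D.unit_closed)
  then obtain u v where uv: "u \<in> U" "v \<in> V" "?e = u \<oplus>\<^bsub>?I\<^esub> v"
    unfolding UV_eq[symmetric] by (auto simp: set_add_def')
  obtain x where x: "x \<in> carrier M" "\<phi> x = u"
    using \<phi>(2) uv(1) by (auto simp: bij_betw_def)
  have "act M h x = x" if h: "h \<in> P" for h
  proof -
    have hG: "h \<in> carrier G" using h subgroup.subset[OF P] by blast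
    \<comment> \<open>The left side is the translate of \<open>?e\<close> by \<open>h\<close>. It
      equals \<open>?e\<close> because \<open>P\<close> acts trivially on \<open>k\<close>;
      uniqueness of components then shows that \<open>h\<close> fixes \<open>u\<close>.\<close>
    have "act ?I h u \<oplus>\<^bsub>?I\<^esub> act ?I h v = u \<oplus>\<^bsub>?I\<^esub> v"
      using D.act_unit_subgroup[OF h, of "\<one>\<^bsub>k\<^esub>"] uv hG by (simp add: D.I.act_add Uc Vc)
    then have "act ?I h u = u"
      using unique actU[OF hG] actV[OF hG] uv by blast
    then have "\<phi> (act M h x) = \<phi> x" using x hG by (simp add: hom_\<phi>)
    then show ?thesis
      using \<phi>(2) x hG M.act_closed by (auto simp: bij_betw_def dest: inj_onD)
  qed
  then have x_fixed: "x \<in> fixed_points M P" using x by (simp add: fixed_points_def)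
  have "f x \<noteq> \<zero>\<^bsub>k\<^esub>"
  proof
    assume fx: "f x = \<zero>\<^bsub>k\<^esub>"
    \<comment> \<open>\<open>W\<close> is the image of the kernel of \<open>f\<close> under
      \<open>\<phi>\<close>, plus \<open>V\<close>. If \<open>f x\<close> vanishes, it is a
      submodule containing the generator \<open>?e\<close>, hence all of \<open>Ind\<close>.\<close>
    define W where "W = {w. \<exists>y\<in>carrier M. \<exists>b\<in>V. f y = \<zero>\<^bsub>k\<^esub> \<and> w = \<phi> y \<oplus>\<^bsub>?I\<^esub> b}"
    have WI: "\<phi> y \<oplus>\<^bsub>?I\<^esub> b \<in> W" if "y \<in> carrier M" "b \<in> V" "f y = \<zero>\<^bsub>k\<^esub>" for y b
      using that by (auto simp: W_def)
    have f0: "f \<zero>\<^bsub>M\<^esub> = \<zero>\<^bsub>k\<^esub>"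
      using hom_f(3)[of "\<zero>\<^bsub>k\<^esub>" "\<zero>\<^bsub>M\<^esub>"] hom_f(1) by simp
    have \<phi>0: "\<phi> \<zero>\<^bsub>M\<^esub> = \<zero>\<^bsub>?I\<^esub>"
      using hom_\<phi>(3)[of "\<zero>\<^bsub>k\<^esub>" "\<zero>\<^bsub>M\<^esub>"] Uc[OF hom_\<phi>(1)] by simp
    have "gsubmodule k G ?I W"
      unfolding gsubmodule_def
    proof (intro conjI ballI)
      show "submodule W k ?I"
      proof (rule D.I.submodule_smultI)
        show "W \<subseteq> carrier ?I" using Uc Vc hom_\<phi>(1) by (auto simp: W_def)
        show "\<zero>\<^bsub>?I\<^esub> \<in> W"
          using WI[of "\<zero>\<^bsub>M\<^esub>" "\<zero>\<^bsub>?I\<^esub>"] f0 \<phi>0 D.I.submodule_zero_closed[OF V] by simp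
      next
        fix a b assume "a \<in> W" "b \<in> W"
        then obtain y c z d where y: "y \<in> carrier M" "c \<in> V" "f y = \<zero>\<^bsub>k\<^esub>" "a = \<phi> y \<oplus>\<^bsub>?I\<^esub> c"
          and z: "z \<in> carrier M" "d \<in> V" "f z = \<zero>\<^bsub>k\<^esub>" "b = \<phi> z \<oplus>\<^bsub>?I\<^esub> d"
          by (auto simp: W_def)
        have "a \<oplus>\<^bsub>?I\<^esub> b = \<phi> (y \<oplus>\<^bsub>M\<^esub> z) \<oplus>\<^bsub>?I\<^esub> (c \<oplus>\<^bsub>?I\<^esub> d)"
          using y z by (simp add: hom_\<phi> Uc Vc D.I.M.a_ac)
        then show "a \<oplus>\<^bsub>?I\<^esub> b \<in> W"
          using WI[of "y \<oplus>\<^bsub>M\<^esub> z" "c \<oplus>\<^bsub>?I\<^esub> d"] y z D.I.submoduleE(5)[OF V] by (simp add: hom_f)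
      next
        fix c a assume c: "c \<in> carrier k" and "a \<in> W"
        then obtain y b where y: "y \<in> carrier M" "b \<in> V" "f y = \<zero>\<^bsub>k\<^esub>" "a = \<phi> y \<oplus>\<^bsub>?I\<^esub> b"
          by (auto simp: W_def)
        then have "c \<odot>\<^bsub>?I\<^esub> a = \<phi> (c \<odot>\<^bsub>M\<^esub> y) \<oplus>\<^bsub>?I\<^esub> (c \<odot>\<^bsub>?I\<^esub> b)"
          using c by (simp add: hom_\<phi> Uc Vc D.I.smult_r_distr)
        then show "c \<odot>\<^bsub>?I\<^esub> a \<in> W"
          using WI[of "c \<odot>\<^bsub>M\<^esub> y" "c \<odot>\<^bsub>?I\<^esub> b"] y c D.I.submoduleE(4)[OF V] by (simp add: hom_f)
      qed
      fix g a assume g: "g \<in> carrier G" and "a \<in> W"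
      then obtain y b where y: "y \<in> carrier M" "b \<in> V" "f y = \<zero>\<^bsub>k\<^esub>" "a = \<phi> y \<oplus>\<^bsub>?I\<^esub> b"
        by (auto simp: W_def)
      then have "act ?I g a = \<phi> (act M g y) \<oplus>\<^bsub>?I\<^esub> act ?I g b"
        using g by (simp add: hom_\<phi> Uc Vc D.I.act_add)
      then show "act ?I g a \<in> W"
        using WI[of "act M g y" "act ?I g b"] y g actV M.act_closed by (simp add: hom_f)
    qed
    moreover have "D.unit n \<in> W" if n: "n \<in> carrier ?T" for n
    proof -
      \<comment> \<open>Over the trivial module every \<open>unit n\<close> is a scalar multiple of
        \<open>?e\<close>, so having \<open>?e\<close> in \<open>W\<close> suffices.\<close>
      have "n \<odot>\<^bsub>tensor_kG G ?T\<^esub> pure_tensor G ?T \<one>\<^bsub>G\<^esub> \<one>\<^bsub>k\<^esub> = pure_tensor G ?T \<one>\<^bsub>G\<^esub> n"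
        using n by (auto simp: tensor_kG_simps pure_tensor_def intro!: restrict_ext)
      then have "D.unit n = n \<odot>\<^bsub>?I\<^esub> ?e"
        using n D.Ind_simps(4)[of n "pure_tensor G ?T \<one>\<^bsub>G\<^esub> \<one>\<^bsub>k\<^esub>"]
          pure_tensor_closed[OF D.N.module_axioms, where n = "\<one>\<^bsub>k\<^esub>" and G = G and g = "\<one>\<^bsub>G\<^esub>"]
        by (simp add: D.unit_def)
      moreover have "?e \<in> W" using WI[of x v] x uv fx by simp
      ultimately show ?thesis
        using \<open>gsubmodule k G ?I W\<close> D.I.submoduleE(4) n by (auto simp: gsubmodule_def)
    qed
    ultimately have W: "W = carrier ?I" by (rule D.Ind_generated)
    have "f y = \<zero>\<^bsub>k\<^esub>" if y: "y \<in> carrier M" for y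
    proof -
      have "\<phi> y \<in> W" using W Uc hom_\<phi>(1) y by simp
      then obtain z b where z: "z \<in> carrier M" "b \<in> V" "f z = \<zero>\<^bsub>k\<^esub>" "\<phi> y = \<phi> z \<oplus>\<^bsub>?I\<^esub> b"
        by (auto simp: W_def)
      \<comment> \<open>Inserting the zero component in \<open>V\<close> lets uniqueness identify
        \<open>\<phi> y\<close> with the image of an element killed by \<open>f\<close>. Thus
        \<open>f\<close> is zero, against its surjectivity.\<close>
      have "\<phi> y \<oplus>\<^bsub>?I\<^esub> \<zero>\<^bsub>?I\<^esub> = \<phi> z \<oplus>\<^bsub>?I\<^esub> b"
        using z Uc[OF hom_\<phi>(1)[OF y]] by simp
      then have "\<phi> y = \<phi> z"
        using unique[OF hom_\<phi>(1)[OF y] hom_\<phi>(1)[OF z(1)] D.I.submodule_zero_closed[OF V] z(2)] by blast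
      then show ?thesis
        using \<phi>(2) y z by (auto simp: bij_betw_def dest: inj_onD)
    qed
    then have "\<one>\<^bsub>k\<^esub> = \<zero>\<^bsub>k\<^esub>" using f(2) by (metis R.one_closed imageE)
    then show False by simp
  qed
  then show ?thesis using that f(1) x_fixed by blast
qed

theorem theorem1p1:
  fixes k :: "('k, 'r) ring_scheme"
    and G :: "('g, 'h) monoid_scheme"
    and P :: "'g set"
    and M :: "('k, 'm, 'g) gmodule"
    and p :: nat
  assumes "algebraically_closed k"
    and "ring_char k = p" and "p > 0"
    and "group G" and "finite (carrier G)"
    and "p_subgroup p P G"
    and "Scott_module k G P M"
  shows "Brauer_indecomposable k G P M \<longleftrightarrow>
    (\<exists>R. R \<lhd> G \<and> R \<subseteq> P \<inter> module_kernel G M \<and>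
      (\<forall>Q. subgroup Q G \<and> R \<subseteq> Q \<and> Q \<subseteq> P \<longrightarrow>
        indecomposable k (G\<lparr>carrier := centralizer G Q\<rparr>) (Brauer G M Q)))"
proof -
  have field: "field k" using assms(1) by (rule algebraically_closed.axioms)
  interpret k: field k by fact
  interpret kG_module k G M using assms(7) by (simp add: Scott_module_def)
  have p: "Factorial_Ring.prime p" using k.ring_char_is_prime assms(2,3) .
  have P: "subgroup P G" using assms(6) by (simp add: p_subgroup_def)
  have finite: "finite Q" if "subgroup Q G" for Q
    using subgroup.subset[OF that] assms(5) finite_subset by blast
  have p_subgroup: "p_subgroup p Q G" if "subgroup Q G" "Q \<subseteq> P" for Q
    using G.p_subgroup_subset[OF assms(6) p that] .
  obtain f x where f: "f \<in> kG_hom k G M (trivial_module k)"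
    and x: "x \<in> fixed_points M P" "f x \<noteq> \<zero>\<^bsub>k\<^esub>"
    using Scott_module_fixed_point[OF field assms(4,5) P assms(7)] by blast
  \<comment> \<open>Excludes the zero alternative in \<open>Brauer_indecomposable\<close>; the one
    \<open>P\<close>-fixed vector \<open>x\<close> serves all \<open>Q\<close> in
    \<open>P\<close>.\<close>
  have nonzero: "carrier (Brauer G M Q) \<noteq> {\<zero>\<^bsub>Brauer G M Q\<^esub>}" if Q: "subgroup Q G" "Q \<subseteq> P" for Q
  proof (rule Brauer_nonzero[OF f assms(2) p p_subgroup[OF Q] finite[OF Q(1)] _ x(2)])
    show "x \<in> fixed_points M Q" using x(1) Q(2) by (auto simp: fixed_points_def)
  qed
  show ?thesis
  proof
    assume BI: "Brauer_indecomposable k G P M"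
    have "indecomposable k (G\<lparr>carrier := centralizer G Q\<rparr>) (Brauer G M Q)"
      if "subgroup Q G" "Q \<subseteq> P" for Q
      using BI[unfolded Brauer_indecomposable_def, rule_format, of Q] nonzero[OF that] that
        Brauer_indecomposable_centralizer_iff[OF that(1) finite[OF that(1)]] by simp
    \<comment> \<open>The trivial subgroup is taken as \<open>R\<close>.\<close>
    moreover have "{\<one>\<^bsub>G\<^esub>} \<subseteq> P \<inter> module_kernel G M"
      using subgroup.one_closed[OF P] act_one by (auto simp: module_kernel_def)
    ultimately show "\<exists>R. R \<lhd> G \<and> R \<subseteq> P \<inter> module_kernel G M \<and>
        (\<forall>Q. subgroup Q G \<and> R \<subseteq> Q \<and> Q \<subseteq> P \<longrightarrow>
          indecomposable k (G\<lparr>carrier := centralizer G Q\<rparr>) (Brauer G M Q))"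
      using G.one_is_normal by blast
  next
    assume "\<exists>R. R \<lhd> G \<and> R \<subseteq> P \<inter> module_kernel G M \<and>
        (\<forall>Q. subgroup Q G \<and> R \<subseteq> Q \<and> Q \<subseteq> P \<longrightarrow>
          indecomposable k (G\<lparr>carrier := centralizer G Q\<rparr>) (Brauer G M Q))"
    then obtain R where R: "R \<lhd> G" "R \<subseteq> P" "R \<subseteq> module_kernel G M"
      and ind: "\<And>Q. \<lbrakk>subgroup Q G; R \<subseteq> Q; Q \<subseteq> P\<rbrakk> \<Longrightarrow>
          indecomposable k (G\<lparr>carrier := centralizer G Q\<rparr>) (Brauer G M Q)"
      by auto
    have "indecomposable k (G\<lparr>carrier := Q <#>\<^bsub>G\<^esub> centralizer G Q\<rparr>) (Brauer G M Q)"
      if Q: "subgroup Q G" "Q \<subseteq> P" for Q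
    proof -
      \<comment> \<open>This subgroup contains \<open>R\<close> and lies in \<open>P\<close>, so the
        hypothesis applies to it, and its Brauer construction is that of \<open>Q\<close>.\<close>
      let ?H = "Q <#>\<^bsub>G\<^esub> R"
      have sR: "subgroup R G" using normal_imp_subgroup R(1) .
      have H: "subgroup ?H G"
        using G.mult_norm_subgroup[OF R(1) Q(1)] G.commut_normal[OF Q(1) R(1)] by simp
      have HP: "?H \<subseteq> P"
        using Q(2) R(2) subgroup.m_closed[OF P] by (auto simp: set_mult_def)
      have QH: "Q \<subseteq> ?H" "R \<subseteq> ?H"
        using subgroup.one_closed[OF sR] subgroup.subset[OF Q(1)]
          subgroup.one_closed[OF Q(1)] subgroup.subset[OF sR] by (force simp: set_mult_def)+
      have "indecomposable k (G\<lparr>carrier := centralizer G ?H\<rparr>) (Brauer G M ?H)"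
        using ind[OF H QH(2) HP] .
      then have "indecomposable k (G\<lparr>carrier := centralizer G ?H\<rparr>) (Brauer G M Q)"
        using Brauer_set_mult_kernel[OF assms(2) p Q(1) R(1,3) p_subgroup[OF H HP] finite[OF H]] by simp
      \<comment> \<open>Centralizing the larger subgroup \<open>?H\<close> implies centralizing
        \<open>Q\<close>, so indecomposability passes up to the larger set of operators.\<close>
      moreover have "centralizer G ?H \<subseteq> Q <#>\<^bsub>G\<^esub> centralizer G Q"
        using QH(1) by (intro subset_trans[OF _ G.centralizer_subset_mult[OF Q(1)]])
          (auto simp: centralizer_def)
      ultimately show ?thesis by (rule indecomposable_mono)
    qed
    then show "Brauer_indecomposable k G P M" by (simp add: Brauer_indecomposable_def)
  qed
qed

end
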